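(* Let $(X,\Sigma,\mu)$ be a complete $\sigma$-finite measure space, $\mathcal{A}\subseteq\Sigma$ a sub-$\sigma$-finite algebra, $E=E^{\mathcal{A}}$ the associated conditional expectation, and $u,w\in\mathcal{D}(E)$ such that $T=M_wEM_u$ is a bounded operator on $L^2(\Sigma)$. Then: (a) If $|E(uw)|^2\geq E(|u|^2)E(|w|^2)$, then $T$ belongs to the quasi-$\ast$-$A$-class. (b) If $T$ belongs to the quasi-$\ast$-$A$-class, then $$|E(uw)|^3(E(|w|^2))^{\frac{1}{2}}\geq (E(|u|^2))^{\frac{3}{2}}(E(|w|^2))^2.$$
   Context: For a sub-$\sigma$-finite algebra $\mathcal{A}\subseteq\Sigma$, $E=E^{\mathcal{A}}$ denotes the conditional expectation: for $f\geq 0$ measurable or $f\in L^2(\Sigma)$, $Ef$ is the unique $\mathcal{A}$-measurable function with $\int_A f\,d\mu=\int_A Ef\,d\mu$ for all $A\in\mathcal{A}$. $\mathcal{D}(E)=\{g\in L^0(\Sigma): E(|g|)\in L^0(\mathcal{A})\}$, where $L^0$ denotes a.e. finite measurable functions. $M_w$ is multiplication by $w$, so $M_wEM_u f=wE(uf)$. All comparisons between functions hold pointwise up to $\mu$-null sets. For a bounded operator $T$ on a Hilbert space, $|T|=(T^*T)^{1/2}$; $T$ belongs to the quasi-$\ast$-$A$-class if $T^*|T^2|T\geq T^*|T^*|^2T$ (as positive operators). *)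

theory Defs
  imports "HOL-Probability.Probability"
begin

text \<open>Conditional expectation of a complex-valued function, extended to D(E) as in the
paper: real and imaginary parts are treated with the library's real_cond_exp, which is
itself E(g+) - E(g-) built from the nonnegative conditional expectation nn_cond_exp.\<close>

definition cE :: "'a measure \<Rightarrow> 'a measure \<Rightarrow> ('a \<Rightarrow> complex) \<Rightarrow> ('a \<Rightarrow> complex)" where
  "cE M F f = (\<lambda>x. complex_of_real (real_cond_exp M F (\<lambda>y. Re (f y)) x)
                   + \<i> * complex_of_real (real_cond_exp M F (\<lambda>y. Im (f y)) x))"

text \<open>D(E) = {g in L0(Sigma) : E(|g|) in L0(A)}, i.e. E(|g|) is a.e. finite.\<close>

definition DE :: "'a measure \<Rightarrow> 'a measure \<Rightarrow> ('a \<Rightarrow> complex) set" where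
  "DE M F = {g. g \<in> borel_measurable M \<and>
                (AE x in M. nn_cond_exp M F (\<lambda>y. ennreal (cmod (g y))) x < \<infinity>)}"

definition L2 :: "'a measure \<Rightarrow> ('a \<Rightarrow> complex) set" where
  "L2 M = {f. f \<in> borel_measurable M \<and> integrable M (\<lambda>x. (cmod (f x))^2)}"

definition l2_inner :: "'a measure \<Rightarrow> ('a \<Rightarrow> complex) \<Rightarrow> ('a \<Rightarrow> complex) \<Rightarrow> complex" where
  "l2_inner M f g = (LINT x|M. f x * cnj (g x))"

definition l2_norm :: "'a measure \<Rightarrow> ('a \<Rightarrow> complex) \<Rightarrow> real" where
  "l2_norm M f = sqrt (LINT x|M. (cmod (f x))^2)"

type_synonym 'a op = "('a \<Rightarrow> complex) \<Rightarrow> ('a \<Rightarrow> complex)"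

text \<open>A bounded (linear) operator on L2, acting on representatives: it maps L2 into L2,
respects a.e. equality, is linear up to null sets, and is norm bounded.\<close>

definition bounded_op :: "'a measure \<Rightarrow> 'a op \<Rightarrow> bool" where
  "bounded_op M T \<longleftrightarrow>
     (\<forall>f\<in>L2 M. T f \<in> L2 M) \<and>
     (\<forall>f\<in>L2 M. \<forall>g\<in>L2 M. (AE x in M. f x = g x) \<longrightarrow> (AE x in M. T f x = T g x)) \<and>
     (\<forall>f\<in>L2 M. \<forall>g\<in>L2 M. \<forall>c::complex.
        AE x in M. T (\<lambda>y. c * f y + g y) x = c * T f x + T g x) \<and>
     (\<exists>C. \<forall>f\<in>L2 M. l2_norm M (T f) \<le> C * l2_norm M f)"

definition is_adjoint :: "'a measure \<Rightarrow> 'a op \<Rightarrow> 'a op \<Rightarrow> bool" where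
  "is_adjoint M T S \<longleftrightarrow> bounded_op M S \<and>
     (\<forall>f\<in>L2 M. \<forall>g\<in>L2 M. l2_inner M (T f) g = l2_inner M f (S g))"

text \<open>Operator order: A \<le> B iff B - A is positive, i.e. <(B-A)f,f> is real and \<ge> 0.\<close>

definition op_le :: "'a measure \<Rightarrow> 'a op \<Rightarrow> 'a op \<Rightarrow> bool" where
  "op_le M A B \<longleftrightarrow> (\<forall>f\<in>L2 M.
      Im (l2_inner M (A f) f) = Im (l2_inner M (B f) f) \<and>
      Re (l2_inner M (A f) f) \<le> Re (l2_inner M (B f) f))"

definition positive_op :: "'a measure \<Rightarrow> 'a op \<Rightarrow> bool" where
  "positive_op M A \<longleftrightarrow> op_le M (\<lambda>f x. 0) A"

definition is_pos_sqrt :: "'a measure \<Rightarrow> 'a op \<Rightarrow> 'a op \<Rightarrow> bool" where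
  "is_pos_sqrt M A R \<longleftrightarrow> bounded_op M R \<and> positive_op M R \<and>
     (\<forall>f\<in>L2 M. AE x in M. R (R f) x = A f x)"

definition is_abs :: "'a measure \<Rightarrow> 'a op \<Rightarrow> 'a op \<Rightarrow> bool" where
  "is_abs M S R \<longleftrightarrow> (\<exists>Ss. is_adjoint M S Ss \<and> is_pos_sqrt M (Ss \<circ> S) R)"

definition quasi_star_A :: "'a measure \<Rightarrow> 'a op \<Rightarrow> bool" where
  "quasi_star_A M T \<longleftrightarrow> bounded_op M T \<and>
     (\<forall>Ts R1 R2. is_adjoint M T Ts \<longrightarrow> is_abs M (T \<circ> T) R1 \<longrightarrow> is_abs M Ts R2 \<longrightarrow>
        op_le M (Ts \<circ> R2 \<circ> R2 \<circ> T) (Ts \<circ> R1 \<circ> T))"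

definition wcte :: "'a measure \<Rightarrow> 'a measure \<Rightarrow> ('a \<Rightarrow> complex) \<Rightarrow> ('a \<Rightarrow> complex) \<Rightarrow> 'a op" where
  "wcte M F w u = (\<lambda>f x. w x * cE M F (\<lambda>y. u y * f y) x)"

end

theory Submission
  imports Defs
begin

text \<open>
  Write \<open>J = E(|u|\<^sup>2)\<close>, \<open>K = E(|w|\<^sup>2)\<close>. Boundedness of \<open>T\<close> forces \<open>J K\<close> to be bounded, and outside
  the set \<open>S\<close> where both are positive and finite the operator vanishes. With the normalisations
  \<open>a = cnj u / \<surd>J\<close>, \<open>b = w / \<surd>K\<close>, \<open>k = \<surd>(J K)\<close> on \<open>S\<close>, one has \<open>T f = k b E(cnj a f)\<close>. Operators of this
  shape are closed under adjoints and products, so \<open>|T\<^sup>2|\<close> is \<open>f \<mapsto> k\<^sup>2 |c| a E(cnj a f)\<close> with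
  \<open>c = E(cnj a b)\<close>, by uniqueness of positive square roots, and the operator inequality
  becomes \<open>k\<^sup>4 \<le> k\<^sup>4 |c|\<^sup>3\<close> almost everywhere.
\<close>

section \<open>Operators on square-integrable functions\<close>

text \<open>\<open>quasi_star_A\<close> quantifies over every adjoint and every absolute value, so
  deducing membership needs uniqueness of these objects, and deducing anything from membership needs
  their existence. The hard case is |T^2|: an arbitrary positive root is not known to commute with
  the explicit one. The exponents arise as follows. The left side is (adjoint T)(T)(adjoint T)(T),
  with multiplier k^4. On the right |T^2| contributes |c|, and the factors around it contribute c
  and its conjugate, whence k^4 |c|^3. On S one has |c| = |E(uw)| / sqrt(J K), so there the
  hypothesis of (a) and the conclusion of (b) both amount to |E(uw)|^2 \<ge> J K; off S almost
  everywhere J or K is 0. A second obstacle is integrability: products such as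
  \<open>cnj (a y) * f y\<close> lie in D(E) but need not be integrable, so additivity of E and the
  extraction of measurable factors must hold on D(E).\<close>

lemma borel_measurable_cnj [measurable (raw)]:
  "f \<in> borel_measurable M \<Longrightarrow> (\<lambda>x. cnj (f x)) \<in> borel_measurable M"
  by (rule borel_measurable_continuous_on[of cnj]) (auto intro: continuous_intros)

lemma L2_D:
  assumes "f \<in> L2 M"
  shows "f \<in> borel_measurable M" "integrable M (\<lambda>x. (cmod (f x))\<^sup>2)"
  using assms by (auto simp: L2_def)

text \<open>The shape with two explicit coefficients is kept throughout, since the inner product
  rules are stated for it; this is why terms such as \<open>1 * f x\<close> or
  \<open>0 * T f x\<close> occur later.\<close>

lemma L2_lincomb:
  assumes "f \<in> L2 M" "g \<in> L2 M"
  shows "(\<lambda>x. c * f x + d * g x) \<in> L2 M"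
    and "(LINT x|M. (cmod (c * f x + d * g x))\<^sup>2)
      \<le> 2 * (cmod c)\<^sup>2 * (LINT x|M. (cmod (f x))\<^sup>2) + 2 * (cmod d)\<^sup>2 * (LINT x|M. (cmod (g x))\<^sup>2)"
proof -
  note [measurable] = L2_D(1)[OF assms(1)] L2_D(1)[OF assms(2)]
  have le: "(cmod (c * f x + d * g x))\<^sup>2 \<le> 2 * (cmod c)\<^sup>2 * (cmod (f x))\<^sup>2 + 2 * (cmod d)\<^sup>2 * (cmod (g x))\<^sup>2" for x
  proof -
    have "cmod (c * f x + d * g x) \<le> cmod c * cmod (f x) + cmod d * cmod (g x)"
      by (metis norm_mult norm_triangle_ineq)
    then have "(cmod (c * f x + d * g x))\<^sup>2 \<le> (cmod c * cmod (f x) + cmod d * cmod (g x))\<^sup>2"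
      by (intro power_mono) auto
    also have "\<dots> \<le> 2 * (cmod c * cmod (f x))\<^sup>2 + 2 * (cmod d * cmod (g x))\<^sup>2"
      using sum_squares_bound[of "cmod c * cmod (f x)" "cmod d * cmod (g x)"]
      by (simp add: power2_sum)
    finally show ?thesis by (simp add: power_mult_distrib)
  qed
  have int: "integrable M (\<lambda>x. 2 * (cmod c)\<^sup>2 * (cmod (f x))\<^sup>2 + 2 * (cmod d)\<^sup>2 * (cmod (g x))\<^sup>2)"
    by (intro Bochner_Integration.integrable_add integrable_mult_right L2_D(2) assms)
  have int': "integrable M (\<lambda>x. (cmod (c * f x + d * g x))\<^sup>2)"
    by (rule Bochner_Integration.integrable_bound[OF int]) (use le in \<open>auto intro!: AE_I2 order_trans[OF le]\<close>)
  then show "(\<lambda>x. c * f x + d * g x) \<in> L2 M" by (auto simp: L2_def)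
  show "(LINT x|M. (cmod (c * f x + d * g x))\<^sup>2)
      \<le> 2 * (cmod c)\<^sup>2 * (LINT x|M. (cmod (f x))\<^sup>2) + 2 * (cmod d)\<^sup>2 * (LINT x|M. (cmod (g x))\<^sup>2)"
    using integral_mono[OF int' int le] assms[THEN L2_D(2)] by simp
qed

lemma L2_inner_integrable:
  assumes "f \<in> L2 M" "g \<in> L2 M"
  shows "integrable M (\<lambda>x. f x * cnj (g x))"
proof -
  note [measurable] = L2_D(1)[OF assms(1)] L2_D(1)[OF assms(2)]
  have "integrable M (\<lambda>x. (cmod (f x))\<^sup>2 + (cmod (g x))\<^sup>2)"
    using assms by (intro Bochner_Integration.integrable_add L2_D)
  then show ?thesis
  proof (rule Bochner_Integration.integrable_bound)
    show "AE x in M. norm (f x * cnj (g x)) \<le> norm ((cmod (f x))\<^sup>2 + (cmod (g x))\<^sup>2)"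
    proof (intro AE_I2)
      fix x
      have "2 * (cmod (f x) * cmod (g x)) \<le> (cmod (f x))\<^sup>2 + (cmod (g x))\<^sup>2"
        using sum_squares_bound[of "cmod (f x)" "cmod (g x)"] by simp
      moreover have "0 \<le> cmod (f x) * cmod (g x)" by simp
      ultimately have "cmod (f x) * cmod (g x) \<le> (cmod (f x))\<^sup>2 + (cmod (g x))\<^sup>2" by linarith
      then show "norm (f x * cnj (g x)) \<le> norm ((cmod (f x))\<^sup>2 + (cmod (g x))\<^sup>2)"
        by (simp add: norm_mult)
    qed
  qed measurable
qed

lemma l2_inner_lincomb_left:
  assumes "f \<in> L2 M" "g \<in> L2 M" "h \<in> L2 M"
  shows "l2_inner M (\<lambda>x. c * f x + d * g x) h = c * l2_inner M f h + d * l2_inner M g h"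
proof -
  have "l2_inner M (\<lambda>x. c * f x + d * g x) h
      = (LINT x|M. c * (f x * cnj (h x)) + d * (g x * cnj (h x)))"
    by (simp add: l2_inner_def algebra_simps)
  also have "\<dots> = c * l2_inner M f h + d * l2_inner M g h"
    by (simp add: l2_inner_def L2_inner_integrable[OF assms(1,3)] L2_inner_integrable[OF assms(2,3)])
  finally show ?thesis .
qed

lemma l2_inner_commute: "l2_inner M f g = cnj (l2_inner M g f)"
  unfolding l2_inner_def by (subst Bochner_Integration.integral_cnj[symmetric]) (simp add: mult.commute)

lemma l2_inner_lincomb_right:
  assumes "f \<in> L2 M" "g \<in> L2 M" "h \<in> L2 M"
  shows "l2_inner M h (\<lambda>x. c * f x + d * g x) = cnj c * l2_inner M h f + cnj d * l2_inner M h g"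
  by (subst (1 2 3) l2_inner_commute) (simp add: l2_inner_lincomb_left assms)

lemma l2_inner_cong:
  assumes "AE x in M. f x = f' x" "AE x in M. g x = g' x"
    and "f \<in> borel_measurable M" "f' \<in> borel_measurable M"
      "g \<in> borel_measurable M" "g' \<in> borel_measurable M"
  shows "l2_inner M f g = l2_inner M f' g'"
  unfolding l2_inner_def
  using assms(1,2) by (intro integral_cong_AE borel_measurable_times borel_measurable_cnj assms(3-6)) auto

lemma l2_inner_self: "l2_inner M f f = complex_of_real (LINT x|M. (cmod (f x))\<^sup>2)"
  by (simp only: l2_inner_def flip: complex_norm_square integral_complex_of_real)

lemma l2_inner_self_eq_0:
  assumes "f \<in> L2 M" "l2_inner M f f = 0"
  shows "AE x in M. f x = 0"
proof -
  have "(LINT x|M. (cmod (f x))\<^sup>2) = 0"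
    using assms(2) by (simp add: l2_inner_self)
  then have "AE x in M. (cmod (f x))\<^sup>2 = 0"
    using integral_nonneg_eq_0_iff_AE[OF L2_D(2)[OF assms(1)]] by simp
  then show ?thesis by simp
qed

text \<open>The difference of the two functions is itself an admissible test vector, and it is
  orthogonal to itself.\<close>

lemma L2_AE_eqI:
  assumes "f \<in> L2 M" "g \<in> L2 M" "\<And>h. h \<in> L2 M \<Longrightarrow> l2_inner M h f = l2_inner M h g"
  shows "AE x in M. f x = g x"
proof -
  let ?h = "\<lambda>x. 1 * f x + (-1) * g x"
  have h: "?h \<in> L2 M" by (intro L2_lincomb assms)
  have "l2_inner M ?h ?h = 0"
    by (subst l2_inner_lincomb_right) (use assms h in auto)
  from l2_inner_self_eq_0[OF h this] show ?thesis by simp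
qed

section \<open>Bounded operators acting on representatives\<close>

lemma bounded_op_L2: "bounded_op M T \<Longrightarrow> f \<in> L2 M \<Longrightarrow> T f \<in> L2 M"
  by (auto simp: bounded_op_def)

lemma bounded_op_meas: "bounded_op M T \<Longrightarrow> f \<in> L2 M \<Longrightarrow> T f \<in> borel_measurable M"
  by (auto simp: bounded_op_def L2_def)

lemma bounded_op_cong:
  "bounded_op M T \<Longrightarrow> f \<in> L2 M \<Longrightarrow> g \<in> L2 M \<Longrightarrow> AE x in M. f x = g x \<Longrightarrow> AE x in M. T f x = T g x"
  by (auto simp: bounded_op_def)

lemma bounded_op_linear:
  "bounded_op M T \<Longrightarrow> f \<in> L2 M \<Longrightarrow> g \<in> L2 M \<Longrightarrow> AE x in M. T (\<lambda>y. c * f y + g y) x = c * T f x + T g x"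
  by (auto simp: bounded_op_def)

lemma L2_zero: "(\<lambda>x. 0) \<in> L2 M"
  by (simp add: L2_def)

lemma bounded_op_lincomb:
  assumes T: "bounded_op M T" and fg: "f \<in> L2 M" "g \<in> L2 M"
  shows "AE x in M. T (\<lambda>y. c * f y + d * g y) x = c * T f x + d * T g x"
proof -
  \<comment> \<open>Linearity at the zero function with coefficient 1 reads T 0 = T 0 + T 0.\<close>
  have z: "AE x in M. T (\<lambda>x. 0) x = 0"
    using bounded_op_linear[OF T L2_zero L2_zero, of 1] by simp
  have dg: "(\<lambda>y. d * g y + 0) \<in> L2 M"
    using L2_lincomb(1)[OF fg(2,2), of d 0] by simp
  have "AE x in M. T (\<lambda>y. d * g y + 0) x = d * T g x + T (\<lambda>x. 0) x"
    by (rule bounded_op_linear[OF T fg(2) L2_zero])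
  moreover have "AE x in M. T (\<lambda>y. c * f y + (d * g y + 0)) x = c * T f x + T (\<lambda>y. d * g y + 0) x"
    by (rule bounded_op_linear[OF T fg(1) dg])
  ultimately show ?thesis using z by eventually_elim simp
qed

lemma bounded_op_diff:
  assumes T: "bounded_op M T" and fg: "f \<in> L2 M" "g \<in> L2 M"
  shows "AE x in M. T (\<lambda>y. f y - g y) x = T f x - T g x"
  using bounded_op_lincomb[OF assms, of 1 "-1"] by simp

lemma bounded_opE:
  assumes "bounded_op M T"
  obtains K where "K \<ge> 0"
    "\<And>f. f \<in> L2 M \<Longrightarrow> (LINT x|M. (cmod (T f x))\<^sup>2) \<le> K * (LINT x|M. (cmod (f x))\<^sup>2)"
proof -
  obtain C where C: "\<And>f. f \<in> L2 M \<Longrightarrow> l2_norm M (T f) \<le> C * l2_norm M f"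
    using assms unfolding bounded_op_def by blast
  have "(LINT x|M. (cmod (T f x))\<^sup>2) \<le> C\<^sup>2 * (LINT x|M. (cmod (f x))\<^sup>2)" if "f \<in> L2 M" for f
  proof -
    have "(l2_norm M (T f))\<^sup>2 \<le> (C * l2_norm M f)\<^sup>2"
      by (rule power_mono[OF C[OF that]]) (simp add: l2_norm_def)
    then show ?thesis by (simp add: l2_norm_def power_mult_distrib)
  qed
  \<comment> \<open>Squaring makes the constant nonnegative, although C itself carries no sign
    condition.\<close>
  with that[of "C\<^sup>2"] show thesis by simp
qed

lemma bounded_opI:
  assumes "\<And>f. f \<in> L2 M \<Longrightarrow> T f \<in> L2 M"
    and "\<And>f g. f \<in> L2 M \<Longrightarrow> g \<in> L2 M \<Longrightarrow> AE x in M. f x = g x \<Longrightarrow> AE x in M. T f x = T g x"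
    and "\<And>f g c. f \<in> L2 M \<Longrightarrow> g \<in> L2 M \<Longrightarrow> AE x in M. T (\<lambda>y. c * f y + g y) x = c * T f x + T g x"
    and "\<And>f. f \<in> L2 M \<Longrightarrow> (LINT x|M. (cmod (T f x))\<^sup>2) \<le> K * (LINT x|M. (cmod (f x))\<^sup>2)"
  shows "bounded_op M T"
proof -
  have "l2_norm M (T f) \<le> sqrt K * l2_norm M f" if "f \<in> L2 M" for f
    using real_sqrt_le_mono[OF assms(4)[OF that]] by (simp add: l2_norm_def real_sqrt_mult)
  with assms(1-3) show ?thesis unfolding bounded_op_def by blast
qed

lemma bounded_op_op_lincomb:
  assumes S: "bounded_op M S" and T: "bounded_op M T"
  shows "bounded_op M (\<lambda>f x. c * S f x + d * T f x)"
proof -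
  obtain K where K: "K \<ge> 0" "\<And>f. f \<in> L2 M \<Longrightarrow> (LINT x|M. (cmod (S f x))\<^sup>2) \<le> K * (LINT x|M. (cmod (f x))\<^sup>2)"
    by (rule bounded_opE[OF S]) blast
  obtain L where L: "L \<ge> 0" "\<And>f. f \<in> L2 M \<Longrightarrow> (LINT x|M. (cmod (T f x))\<^sup>2) \<le> L * (LINT x|M. (cmod (f x))\<^sup>2)"
    by (rule bounded_opE[OF T]) blast
  show ?thesis
  proof (rule bounded_opI)
    fix f assume f: "f \<in> L2 M"
    show "(\<lambda>x. c * S f x + d * T f x) \<in> L2 M"
      by (intro L2_lincomb bounded_op_L2[OF S] bounded_op_L2[OF T] f)
    have "(LINT x|M. (cmod (c * S f x + d * T f x))\<^sup>2)
      \<le> 2 * (cmod c)\<^sup>2 * (LINT x|M. (cmod (S f x))\<^sup>2) + 2 * (cmod d)\<^sup>2 * (LINT x|M. (cmod (T f x))\<^sup>2)"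
      by (intro L2_lincomb bounded_op_L2[OF S] bounded_op_L2[OF T] f)
    also have "\<dots> \<le> 2 * (cmod c)\<^sup>2 * (K * (LINT x|M. (cmod (f x))\<^sup>2)) + 2 * (cmod d)\<^sup>2 * (L * (LINT x|M. (cmod (f x))\<^sup>2))"
      by (intro add_mono mult_left_mono K L f) auto
    finally show "(LINT x|M. (cmod (c * S f x + d * T f x))\<^sup>2)
        \<le> (2 * (cmod c)\<^sup>2 * K + 2 * (cmod d)\<^sup>2 * L) * (LINT x|M. (cmod (f x))\<^sup>2)"
      by (simp add: algebra_simps)
  next
    fix f g assume fg: "f \<in> L2 M" "g \<in> L2 M"
    show "AE x in M. c * S f x + d * T f x = c * S g x + d * T g x" if "AE x in M. f x = g x"
      using bounded_op_cong[OF S fg that] bounded_op_cong[OF T fg that] by eventually_elim simp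
    show "AE x in M. c * S (\<lambda>y. b * f y + g y) x + d * T (\<lambda>y. b * f y + g y) x
        = b * (c * S f x + d * T f x) + (c * S g x + d * T g x)" for b
      using bounded_op_linear[OF S fg, of b] bounded_op_linear[OF T fg, of b] by eventually_elim (simp add: algebra_simps)
  qed
qed

section \<open>Positive operators and uniqueness of their square roots\<close>

lemma positive_opD:
  assumes "positive_op M R" "f \<in> L2 M"
  shows "Im (l2_inner M (R f) f) = 0" "0 \<le> Re (l2_inner M (R f) f)"
  using assms by (auto simp: positive_op_def op_le_def l2_inner_def)

lemma positive_opI:
  assumes "\<And>f. f \<in> L2 M \<Longrightarrow> Im (l2_inner M (R f) f) = 0" "\<And>f. f \<in> L2 M \<Longrightarrow> 0 \<le> Re (l2_inner M (R f) f)"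
  shows "positive_op M R"
  using assms by (auto simp: positive_op_def op_le_def l2_inner_def)

text \<open>Polarisation: the form of R is real at f + g and at i f + g. The first fact makes the
  imaginary parts of <R f, g> and <R g, f> opposite, the second makes their real parts
  equal.\<close>

lemma positive_op_selfadjoint:
  assumes R: "bounded_op M R" and pos: "positive_op M R" and f: "f \<in> L2 M" and g: "g \<in> L2 M"
  shows "l2_inner M (R f) g = l2_inner M f (R g)"
proof -
  have expand: "l2_inner M (R (\<lambda>x. c * f x + 1 * g x)) (\<lambda>x. c * f x + 1 * g x)
      = c * cnj c * l2_inner M (R f) f + c * l2_inner M (R f) g
        + cnj c * l2_inner M (R g) f + l2_inner M (R g) g" for c
  proof -
    have h: "(\<lambda>x. c * f x + 1 * g x) \<in> L2 M" by (intro L2_lincomb f g)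
    have "l2_inner M (R (\<lambda>x. c * f x + 1 * g x)) (\<lambda>x. c * f x + 1 * g x)
        = l2_inner M (\<lambda>x. c * R f x + 1 * R g x) (\<lambda>x. c * f x + 1 * g x)"
      by (rule l2_inner_cong)
        (use bounded_op_lincomb[OF R f g, of c 1] bounded_op_meas[OF R h] bounded_op_meas[OF R f]
          bounded_op_meas[OF R g] L2_D(1)[OF f] L2_D(1)[OF g] in auto)
    also have "\<dots> = c * cnj c * l2_inner M (R f) f + c * l2_inner M (R f) g
        + cnj c * l2_inner M (R g) f + l2_inner M (R g) g"
      by (subst l2_inner_lincomb_left l2_inner_lincomb_right;
          (intro bounded_op_L2[OF R] f g h)?)+ (simp add: algebra_simps)
    finally show ?thesis .
  qed
  have "Im (c * cnj c * l2_inner M (R f) f + c * l2_inner M (R f) g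
        + cnj c * l2_inner M (R g) f + l2_inner M (R g) g) = 0" for c
    unfolding expand[symmetric] by (rule positive_opD[OF pos]) (intro L2_lincomb f g)
  from this[of 1] this[of \<i>] have "Im (l2_inner M (R f) g) = - Im (l2_inner M (R g) f)"
      "Re (l2_inner M (R f) g) = Re (l2_inner M (R g) f)"
    using positive_opD[OF pos f] positive_opD[OF pos g] by auto
  then have "l2_inner M (R f) g = cnj (l2_inner M (R g) f)"
    by (simp add: complex_eq_iff)
  then show ?thesis using l2_inner_commute[of M f "R g"] by simp
qed

text \<open>This is 0 \<le> S \<le> 1 in the order of quadratic forms. That form of the bound is
  what the estimates below consume, and it is reached from any positive bounded operator by a small
  scalar factor.\<close>

locale l2_contraction =
  fixes M :: "'a measure" and S :: "'a op"
  assumes bdd: "bounded_op M S"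
    and pos: "positive_op M S"
    and le1: "\<And>f. f \<in> L2 M \<Longrightarrow> Re (l2_inner M (S f) f) \<le> Re (l2_inner M f f)"
begin

lemma S_L2: "f \<in> L2 M \<Longrightarrow> S f \<in> L2 M"
  by (rule bounded_op_L2[OF bdd])

lemma expand_norm:
  assumes f: "f \<in> L2 M" 
  shows "Re (l2_inner M (\<lambda>x. f x + of_real s * S f x) (\<lambda>x. f x + of_real s * S f x))
    = Re (l2_inner M f f) + 2 * s * Re (l2_inner M (S f) f) + s\<^sup>2 * Re (l2_inner M (S f) (S f))"
proof -
  let ?g = "\<lambda>x. 1 * f x + of_real s * S f x"
  have g: "?g \<in> L2 M" by (intro L2_lincomb f S_L2)
  have "l2_inner M ?g ?g = l2_inner M f f + of_real s * l2_inner M (S f) f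
      + of_real s * l2_inner M f (S f) + of_real s * of_real s * l2_inner M (S f) (S f)"
    by (subst l2_inner_lincomb_left l2_inner_lincomb_right; (intro S_L2 f g)?)+ (simp add: algebra_simps)
  then show ?thesis
    using positive_op_selfadjoint[OF bdd pos f f] by (simp add: power2_eq_square)
qed

lemma expand_form:
  assumes f: "f \<in> L2 M" 
  shows "Re (l2_inner M (S (\<lambda>x. f x + of_real s * S f x)) (\<lambda>x. f x + of_real s * S f x))
    = Re (l2_inner M (S f) f) + 2 * s * Re (l2_inner M (S f) (S f)) + s\<^sup>2 * Re (l2_inner M (S (S f)) (S f))"
proof -
  let ?g = "\<lambda>x. 1 * f x + of_real s * S f x"
  have g: "?g \<in> L2 M" by (intro L2_lincomb f S_L2)
  have "l2_inner M (S ?g) ?g = l2_inner M (\<lambda>x. 1 * S f x + of_real s * S (S f) x) ?g"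
    by (rule l2_inner_cong[OF bounded_op_lincomb[OF bdd f S_L2[OF f]]]; (intro L2_D(1) S_L2 L2_lincomb f)?) simp
  also have "\<dots> = l2_inner M (S f) f + of_real s * l2_inner M (S (S f)) f
      + of_real s * l2_inner M (S f) (S f) + of_real s * of_real s * l2_inner M (S (S f)) (S f)"
    by (subst l2_inner_lincomb_left l2_inner_lincomb_right; (intro S_L2 f g)?)+ (simp add: algebra_simps)
  finally show ?thesis
    using positive_op_selfadjoint[OF bdd pos S_L2[OF f] f] by (simp add: power2_eq_square)
qed

text \<open>This is S^2 \<le> S. Positivity at f - S f gives 2 |S f|^2 \<le> <S f, f> + <S S f, S
  f>, and the last term is at most |S f|^2 because S \<le> 1.\<close>

lemma norm_le_form:
  assumes f: "f \<in> L2 M"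
  shows "Re (l2_inner M (S f) (S f)) \<le> Re (l2_inner M (S f) f)"
proof -
  have "(\<lambda>x. f x + of_real (-1) * S f x) \<in> L2 M"
    using L2_lincomb(1)[OF f S_L2[OF f], of 1 "-1"] by simp
  then have "0 \<le> Re (l2_inner M (S (\<lambda>x. f x + of_real (-1) * S f x)) (\<lambda>x. f x + of_real (-1) * S f x))"
    by (rule positive_opD[OF pos])
  then show ?thesis
    using expand_form[OF f, of "-1"] le1[OF S_L2[OF f]] by simp
qed

lemma form_eq_0:
  assumes f: "f \<in> L2 M" and 0: "Re (l2_inner M (S f) f) = 0"
  shows "AE x in M. S f x = 0"
proof (rule l2_inner_self_eq_0[OF S_L2[OF f]])
  have "(LINT x|M. (cmod (S f x))\<^sup>2) \<ge> 0" by simp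
  then show "l2_inner M (S f) (S f) = 0"
    using norm_le_form[OF f] 0 unfolding l2_inner_self by (simp only: Re_complex_of_real of_real_eq_0_iff)
qed

text \<open>Since \<open>(1 + S)\<^sup>n D = D (1 - S)\<^sup>n\<close>, the vectors \<open>(1 + S)\<^sup>n D y\<close> stay bounded, whereas their
  squared norm grows by at least \<open>2 \<langle>S D y, D y\<rangle>\<close> in each step.\<close>

lemma anticommute_form_eq_0:
  assumes D: "bounded_op M D"
    and anti: "\<And>f. f \<in> L2 M \<Longrightarrow> AE x in M. S (D f) x = - D (S f) x"
    and y: "y \<in> L2 M"
  shows "Re (l2_inner M (S (D y)) (D y)) = 0"
proof -
  \<comment> \<open>\<open>Y n\<close> is (1 - S)^n y and \<open>Z n\<close> is (1 + S)^n D y; the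
    factor \<open>of_real\<close> keeps both in the shape of the expansion lemmas, used with s = -1
    and s = 1.\<close>
  define Y where "Y = rec_nat y (\<lambda>_ f x. f x + of_real (-1) * S f x)"
  define Z where "Z = rec_nat (D y) (\<lambda>_ f x. f x + of_real 1 * S f x)"
  let ?N = "\<lambda>f. Re (l2_inner M f f)"
  let ?q = "\<lambda>f. Re (l2_inner M (S f) f)"
  have Y_Suc: "Y (Suc n) = (\<lambda>x. Y n x + of_real (-1) * S (Y n) x)" and Y_0: "Y 0 = y" for n
    by (simp_all add: Y_def)
  have Z_Suc: "Z (Suc n) = (\<lambda>x. Z n x + of_real 1 * S (Z n) x)" and Z_0: "Z 0 = D y" for n
    by (simp_all add: Z_def)
  have step: "f \<in> L2 M \<Longrightarrow> (\<lambda>x. f x + c * S f x) \<in> L2 M" for f c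
    using L2_lincomb(1)[of f M "S f" 1 c] S_L2[of f] by simp
  have Y: "Y n \<in> L2 M" for n by (induction n) (auto simp only: Y_0 Y_Suc y intro!: step)
  have Z: "Z n \<in> L2 M" for n by (induction n) (auto simp only: Z_0 Z_Suc intro!: step bounded_op_L2[OF D y])
  \<comment> \<open>Anticommutation turns D (1 - S) into (1 + S) D, one factor at a time.\<close>
  have DY: "AE x in M. Z n x = D (Y n) x" for n
  proof (induction n)
    case (Suc n)
    have "AE x in M. S (Z n) x = S (D (Y n)) x"
      by (rule bounded_op_cong[OF bdd Z bounded_op_L2[OF D Y] Suc])
    moreover have "AE x in M. D (\<lambda>x. Y n x - S (Y n) x) x = D (Y n) x - D (S (Y n)) x"
      by (rule bounded_op_diff[OF D Y S_L2[OF Y]])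
    ultimately show ?case using Suc anti[OF Y, of n] unfolding Y_Suc Z_Suc by eventually_elim simp
  qed (simp add: Y_0 Z_0)
  obtain K where K: "K \<ge> 0"
    "\<And>f. f \<in> L2 M \<Longrightarrow> (LINT x|M. (cmod (D f x))\<^sup>2) \<le> K * (LINT x|M. (cmod (f x))\<^sup>2)"
    by (rule bounded_opE[OF D]) blast
  \<comment> \<open>The increment is -2 <S Y, Y> + |S Y|^2, which is at most -<S Y, Y> by S^2 \<le>
    S.\<close>
  have NY: "?N (Y n) \<le> ?N y" for n
  proof (induction n)
    case (Suc n)
    have "?N (Y (Suc n)) \<le> ?N (Y n)"
      using expand_norm[OF Y[of n], of "-1"] norm_le_form[OF Y, of n] positive_opD(2)[OF pos Y, of n]
      unfolding Y_Suc by simp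
    with Suc show ?case by simp
  qed (simp add: Y_0)
  have NZ_le: "?N (Z n) \<le> K * ?N y" for n
  proof -
    have "?N (Z n) = ?N (D (Y n))"
      using l2_inner_cong[OF DY DY] L2_D(1)[OF Z] bounded_op_meas[OF D Y] by simp
    also have "\<dots> \<le> K * ?N (Y n)" using K(2)[OF Y, of n] by (simp add: l2_inner_self)
    also have "\<dots> \<le> K * ?N y" by (intro mult_left_mono NY K)
    finally show ?thesis .
  qed
  have nn: "0 \<le> ?N f" for f by (simp add: l2_inner_self)
  \<comment> \<open>The form grows by 2 |S Z|^2 + <S S Z, S Z>, hence never falls below its initial
    value; this makes the growth of the squared norm at least linear in n.\<close>
  have q: "?q (D y) \<le> ?q (Z n)" for n
  proof (induction n)
    case (Suc n)
    have "?q (Z n) \<le> ?q (Z (Suc n))"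
      using expand_form[OF Z[of n], of 1] positive_opD(2)[OF pos S_L2[OF Z], of n] nn[of "S (Z n)"]
      unfolding Z_Suc by simp
    with Suc show ?case by simp
  qed (simp add: Z_0)
  have NZ_ge: "2 * real n * ?q (D y) \<le> ?N (Z n)" for n
  proof (induction n)
    case (Suc n)
    have "?N (Z n) + 2 * ?q (D y) \<le> ?N (Z (Suc n))"
      using expand_norm[OF Z[of n], of 1] nn[of "S (Z n)"] q[of n]
      unfolding Z_Suc by simp
    with Suc show ?case by (simp add: algebra_simps)
  qed (simp add: nn)
  have "\<not> 0 < ?q (D y)"
  proof
    assume *: "0 < ?q (D y)"
    obtain n where "K * ?N y / (2 * ?q (D y)) < real n" using reals_Archimedean2 by blast
    then have "K * ?N y < 2 * real n * ?q (D y)" using * by (simp add: field_simps)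
    with NZ_ge[of n] NZ_le[of n] show False by linarith
  qed
  with positive_opD(2)[OF pos bounded_op_L2[OF D y]] show ?thesis by linarith
qed

end

text \<open>Expanding |T f - f|^2 \<ge> 0 bounds the form of T by (K + 1) |f|^2, where K bounds the
  squared norm of T; so every positive factor up to 1 / (K + 1) works.\<close>

lemma l2_contraction_scaled:
  assumes T: "bounded_op M T" "positive_op M T"
  obtains r where "r > 0" "\<And>s. 0 < s \<Longrightarrow> s \<le> r \<Longrightarrow> l2_contraction M (\<lambda>f x. of_real s * T f x + 0 * T f x)"
proof -
  obtain K where K: "K \<ge> 0"
    "\<And>f. f \<in> L2 M \<Longrightarrow> (LINT x|M. (cmod (T f x))\<^sup>2) \<le> K * (LINT x|M. (cmod (f x))\<^sup>2)"
    by (rule bounded_opE[OF T(1)]) blast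
  have inner: "l2_inner M (\<lambda>x. of_real s * T f x + 0 * T f x) f = of_real s * l2_inner M (T f) f"
    if "f \<in> L2 M" for f s
    using l2_inner_lincomb_left[OF bounded_op_L2[OF T(1) that] bounded_op_L2[OF T(1) that] that, of s 0] by simp
  have bound: "Re (l2_inner M (T f) f) \<le> (K + 1) * Re (l2_inner M f f)" if f: "f \<in> L2 M" for f
  proof -
    note Tf = bounded_op_L2[OF T(1) f]
    let ?h = "\<lambda>x. 1 * T f x + (-1) * f x"
    have h: "?h \<in> L2 M" by (intro L2_lincomb Tf f)
    have "0 \<le> Re (l2_inner M ?h ?h)" by (simp add: l2_inner_self)
    also have "l2_inner M ?h ?h = l2_inner M (T f) (T f) - l2_inner M (T f) f - l2_inner M f (T f) + l2_inner M f f"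
      by (subst l2_inner_lincomb_left l2_inner_lincomb_right; (intro Tf f h)?)+ simp
    also have "l2_inner M f (T f) = cnj (l2_inner M (T f) f)" by (rule l2_inner_commute)
    finally have "2 * Re (l2_inner M (T f) f) \<le> Re (l2_inner M (T f) (T f)) + Re (l2_inner M f f)" by simp
    also have "\<dots> \<le> K * Re (l2_inner M f f) + Re (l2_inner M f f)"
      using K(2)[OF f] by (simp add: l2_inner_self)
    \<comment> \<open>The factor 2 on the left is simply given up, which is allowed because the form
      is nonnegative.\<close>
    finally show ?thesis using positive_opD(2)[OF T(2) f] by (simp add: algebra_simps)
  qed
  show thesis
  proof
    show "0 < 1 / (K + 1)" using K(1) by simp
    fix s :: real assume s: "0 < s" "s \<le> 1 / (K + 1)"
    show "l2_contraction M (\<lambda>f x. of_real s * T f x + 0 * T f x)"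
    proof
      show "bounded_op M (\<lambda>f x. of_real s * T f x + 0 * T f x)" by (intro bounded_op_op_lincomb T)
      show "positive_op M (\<lambda>f x. of_real s * T f x + 0 * T f x)"
        by (rule positive_opI) (use positive_opD[OF T(2)] s in \<open>simp_all only: inner, simp_all\<close>)
      fix f assume f: "f \<in> L2 M"
      have "s * Re (l2_inner M (T f) f) \<le> s * ((K + 1) * Re (l2_inner M f f))"
        using s by (intro mult_left_mono bound f) auto
      also have "\<dots> = (s * (K + 1)) * Re (l2_inner M f f)" by simp
      also have "\<dots> \<le> 1 * Re (l2_inner M f f)"
        by (rule mult_right_mono) (use s K(1) in \<open>auto simp: field_simps l2_inner_self\<close>)
      finally show "Re (l2_inner M (\<lambda>x. of_real s * T f x + 0 * T f x) f) \<le> Re (l2_inner M f f)"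
        by (simp only: inner[OF f]) simp
    qed
  qed
qed

lemma positive_op_form_eq_0:
  assumes T: "bounded_op M T" "positive_op M T" and f: "f \<in> L2 M" and 0: "Re (l2_inner M (T f) f) = 0"
  shows "AE x in M. T f x = 0"
proof -
  obtain r where r: "r > 0" "\<And>s. 0 < s \<Longrightarrow> s \<le> r \<Longrightarrow> l2_contraction M (\<lambda>f x. of_real s * T f x + 0 * T f x)"
    by (rule l2_contraction_scaled[OF T]) blast
  interpret l2_contraction M "\<lambda>f x. of_real r * T f x + 0 * T f x" by (rule r(2)) (use r(1) in auto)
  have "AE x in M. of_real r * T f x + 0 * T f x = 0"
    using l2_inner_lincomb_left[OF bounded_op_L2[OF T(1) f] bounded_op_L2[OF T(1) f] f, of r 0] 0
    by (intro form_eq_0 f) simp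
  then show ?thesis using r(1) by simp
qed

text \<open>No commutation of R and P is available. Instead A = R + P and D = R - P anticommute,
  because R^2 = P^2 cancels in both products. Hence the form of A vanishes at v = D f; as it is a
  sum of two nonnegative forms, R v = P v = 0. Self-adjointness then gives |v|^2 = <f, R v> - <f, P
  v> = 0.\<close>

theorem positive_sqrt_unique:
  assumes R: "bounded_op M R" "positive_op M R" and P: "bounded_op M P" "positive_op M P"
    and eq: "\<And>f. f \<in> L2 M \<Longrightarrow> AE x in M. R (R f) x = P (P f) x"
    and f: "f \<in> L2 M"
  shows "AE x in M. R f x = P f x"
proof -
  note L2R = bounded_op_L2[OF R(1)] and L2P = bounded_op_L2[OF P(1)]
  define A :: "'a op" where "A = (\<lambda>f x. 1 * R f x + 1 * P f x)"
  define D :: "'a op" where "D = (\<lambda>f x. 1 * R f x + (-1) * P f x)"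
  have A: "bounded_op M A" and D: "bounded_op M D"
    unfolding A_def D_def by (intro bounded_op_op_lincomb R P)+
  have formA: "l2_inner M (A g) h = l2_inner M (R g) h + l2_inner M (P g) h" if "g \<in> L2 M" "h \<in> L2 M" for g h
    using l2_inner_lincomb_left[OF L2R[OF that(1)] L2P[OF that(1)] that(2), of 1 1] by (simp add: A_def)
  have posA: "positive_op M A"
    by (rule positive_opI) (use positive_opD[OF R(2)] positive_opD[OF P(2)] in \<open>auto simp: formA\<close>)
  have anti: "AE x in M. A (D g) x = - D (A g) x" if g: "g \<in> L2 M" for g
  proof -
    note l = bounded_op_lincomb[OF R(1) L2R[OF g] L2P[OF g]] bounded_op_lincomb[OF P(1) L2R[OF g] L2P[OF g]]
    show ?thesis
      using l(1)[of 1 1] l(2)[of 1 1] l(1)[of 1 "-1"] l(2)[of 1 "-1"] eq[OF g]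
      unfolding A_def D_def by eventually_elim simp
  qed
  obtain r where r: "r > 0" "\<And>s. 0 < s \<Longrightarrow> s \<le> r \<Longrightarrow> l2_contraction M (\<lambda>f x. of_real s * A f x + 0 * A f x)"
    by (rule l2_contraction_scaled[OF A posA]) blast
  interpret l2_contraction M "\<lambda>f x. of_real r * A f x + 0 * A f x" by (rule r(2)) (use r(1) in auto)
  let ?v = "D f"
  have v: "?v \<in> L2 M" by (rule bounded_op_L2[OF D f])
  have "Re (l2_inner M (\<lambda>x. of_real r * A ?v x + 0 * A ?v x) ?v) = 0"
  proof (rule anticommute_form_eq_0[OF D _ f])
    fix g assume g: "g \<in> L2 M"
    note Ag = bounded_op_L2[OF A g]
    show "AE x in M. of_real r * A (D g) x + 0 * A (D g) x = - D (\<lambda>x. of_real r * A g x + 0 * A g x) x"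
      using anti[OF g] bounded_op_lincomb[OF D Ag Ag, of r 0] by eventually_elim simp
  qed
  then have "Re (l2_inner M (A ?v) ?v) = 0"
    using r(1) l2_inner_lincomb_left[OF bounded_op_L2[OF A v] bounded_op_L2[OF A v] v, of r 0] by simp
  then have "Re (l2_inner M (R ?v) ?v) = 0" "Re (l2_inner M (P ?v) ?v) = 0"
    using formA[OF v v] positive_opD(2)[OF R(2) v] positive_opD(2)[OF P(2) v] by auto
  then have R0: "AE x in M. R ?v x = 0" and P0: "AE x in M. P ?v x = 0"
    by (simp_all add: positive_op_form_eq_0[OF R v] positive_op_form_eq_0[OF P v])
  have "l2_inner M ?v ?v = l2_inner M (R f) ?v - l2_inner M (P f) ?v"
    using l2_inner_lincomb_left[OF L2R[OF f] L2P[OF f] v, of 1 "-1"] by (simp add: D_def)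
  also have "\<dots> = l2_inner M f (R ?v) - l2_inner M f (P ?v)"
    by (simp add: positive_op_selfadjoint[OF R f v] positive_op_selfadjoint[OF P f v])
  also have "l2_inner M f (R ?v) = l2_inner M f (\<lambda>x. 0)"
    by (rule l2_inner_cong) (use R0 L2_D(1)[OF f] L2_D(1)[OF L2R[OF v]] in auto)
  also have "l2_inner M f (P ?v) = l2_inner M f (\<lambda>x. 0)"
    by (rule l2_inner_cong) (use P0 L2_D(1)[OF f] L2_D(1)[OF L2P[OF v]] in auto)
  finally have "AE x in M. ?v x = 0" by (intro l2_inner_self_eq_0 v) simp
  then show ?thesis by (simp add: D_def)
qed

section \<open>Almost everywhere equality of operators, composition and adjoints\<close>

definition op_eq :: "'a measure \<Rightarrow> 'a op \<Rightarrow> 'a op \<Rightarrow> bool" where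
  "op_eq M A B \<longleftrightarrow> (\<forall>f\<in>L2 M. AE x in M. A f x = B f x)"

lemma op_eqI: "(\<And>f. f \<in> L2 M \<Longrightarrow> AE x in M. A f x = B f x) \<Longrightarrow> op_eq M A B"
  and op_eqD: "op_eq M A B \<Longrightarrow> f \<in> L2 M \<Longrightarrow> AE x in M. A f x = B f x"
  by (auto simp: op_eq_def)

lemma op_eq_sym: "op_eq M A B \<Longrightarrow> op_eq M B A"
  by (auto simp: op_eq_def eq_commute)

lemma op_eq_trans [trans]: "op_eq M A B \<Longrightarrow> op_eq M B C \<Longrightarrow> op_eq M A C"
  unfolding op_eq_def by (fastforce elim: eventually_elim2)

text \<open>Replacing the inner operator changes its value on a null set only, and the outer
  operator must respect this; that is part of \<open>bounded_op\<close>.\<close>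

lemma op_eq_comp:
  assumes "op_eq M A A'" "op_eq M B B'" "bounded_op M A" "bounded_op M B" "bounded_op M B'"
  shows "op_eq M (A \<circ> B) (A' \<circ> B')"
proof (rule op_eqI)
  fix f assume f: "f \<in> L2 M"
  have "AE x in M. A (B f) x = A (B' f) x"
    by (intro bounded_op_cong[OF assms(3)] bounded_op_L2[OF assms(4) f] bounded_op_L2[OF assms(5) f] op_eqD[OF assms(2) f])
  moreover have "AE x in M. A (B' f) x = A' (B' f) x"
    by (intro op_eqD[OF assms(1)] bounded_op_L2[OF assms(5) f])
  ultimately show "AE x in M. (A \<circ> B) f x = (A' \<circ> B') f x" by eventually_elim simp
qed

lemma bounded_op_comp:
  assumes A: "bounded_op M A" and B: "bounded_op M B"
  shows "bounded_op M (A \<circ> B)"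
proof -
  obtain K where K: "K \<ge> 0" "\<And>f. f \<in> L2 M \<Longrightarrow> (LINT x|M. (cmod (A f x))\<^sup>2) \<le> K * (LINT x|M. (cmod (f x))\<^sup>2)"
    by (rule bounded_opE[OF A]) blast
  obtain L where L: "L \<ge> 0" "\<And>f. f \<in> L2 M \<Longrightarrow> (LINT x|M. (cmod (B f x))\<^sup>2) \<le> L * (LINT x|M. (cmod (f x))\<^sup>2)"
    by (rule bounded_opE[OF B]) blast
  note L2A = bounded_op_L2[OF A] and L2B = bounded_op_L2[OF B]
  show ?thesis
  proof (rule bounded_opI)
    fix f assume f: "f \<in> L2 M"
    show "(A \<circ> B) f \<in> L2 M" using L2A L2B f by simp
    have "(LINT x|M. (cmod (A (B f) x))\<^sup>2) \<le> K * (LINT x|M. (cmod (B f x))\<^sup>2)" by (intro K L2B f)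
    also have "\<dots> \<le> K * (L * (LINT x|M. (cmod (f x))\<^sup>2))" by (intro mult_left_mono K L f)
    finally show "(LINT x|M. (cmod ((A \<circ> B) f x))\<^sup>2) \<le> (K * L) * (LINT x|M. (cmod (f x))\<^sup>2)" by simp
  next
    fix f g assume fg: "f \<in> L2 M" "g \<in> L2 M"
    show "AE x in M. (A \<circ> B) f x = (A \<circ> B) g x" if "AE x in M. f x = g x"
      using bounded_op_cong[OF A L2B[OF fg(1)] L2B[OF fg(2)] bounded_op_cong[OF B fg that]] by simp
    fix c
    have "AE x in M. A (B (\<lambda>y. c * f y + g y)) x = A (\<lambda>x. c * B f x + B g x) x"
      using L2_lincomb(1)[OF fg, of c 1] L2_lincomb(1)[OF L2B[OF fg(1)] L2B[OF fg(2)], of c 1]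
      by (intro bounded_op_cong[OF A] L2B bounded_op_linear[OF B] fg) simp_all
    with bounded_op_linear[OF A L2B[OF fg(1)] L2B[OF fg(2)], of c]
    show "AE x in M. (A \<circ> B) (\<lambda>y. c * f y + g y) x = c * (A \<circ> B) f x + (A \<circ> B) g x"
      by eventually_elim simp
  qed
qed

text \<open>Allowing two operators that agree almost everywhere lets an arbitrary adjoint of T be
  compared with the explicit adjoint of its normal form.\<close>

lemma adjoint_unique:
  assumes "is_adjoint M T S" "is_adjoint M T' S'" "op_eq M T T'" "bounded_op M T" "bounded_op M T'"
  shows "op_eq M S S'"
proof (rule op_eqI)
  fix f assume f: "f \<in> L2 M"
  have S: "bounded_op M S" "bounded_op M S'" using assms by (auto simp: is_adjoint_def)
  show "AE x in M. S f x = S' f x"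
  proof (rule L2_AE_eqI)
    fix h assume h: "h \<in> L2 M"
    have "l2_inner M h (S f) = l2_inner M (T h) f" using assms(1) f h by (simp add: is_adjoint_def)
    also have "\<dots> = l2_inner M (T' h) f"
      by (rule l2_inner_cong[OF op_eqD[OF assms(3) h] AE_I2])
        (use L2_D(1)[OF f] bounded_op_meas[OF assms(4) h] bounded_op_meas[OF assms(5) h] in auto)
    also have "\<dots> = l2_inner M h (S' f)" using assms(2) f h by (simp add: is_adjoint_def)
    finally show "l2_inner M h (S f) = l2_inner M h (S' f)" .
  qed (use S f bounded_op_L2 in auto)
qed

lemma is_adjoint_op_eq:
  assumes "is_adjoint M T S" "op_eq M T T'" "bounded_op M T" "bounded_op M T'"
  shows "is_adjoint M T' S"
  unfolding is_adjoint_def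
proof (intro conjI ballI)
  fix f g assume f: "f \<in> L2 M" and g: "g \<in> L2 M"
  have "l2_inner M (T' f) g = l2_inner M (T f) g"
    by (rule l2_inner_cong[OF op_eqD[OF op_eq_sym[OF assms(2)] f] AE_I2])
        (use L2_D(1)[OF g] bounded_op_meas[OF assms(4) f] bounded_op_meas[OF assms(3) f] in auto)
  also have "\<dots> = l2_inner M f (S g)" using assms(1) f g by (simp add: is_adjoint_def)
  finally show "l2_inner M (T' f) g = l2_inner M f (S g)" .
qed (use assms in \<open>auto simp: is_adjoint_def\<close>)

lemma l2_inner_op_eq:
  assumes "op_eq M A A'" "bounded_op M A" "bounded_op M A'" "f \<in> L2 M" "g \<in> L2 M"
  shows "l2_inner M (A f) g = l2_inner M (A' f) g"
  by (rule l2_inner_cong[OF op_eqD[OF assms(1,4)] AE_I2])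
    (use L2_D(1)[OF assms(5)] bounded_op_meas[OF assms(2,4)] bounded_op_meas[OF assms(3,4)] in auto)

lemma op_le_cong:
  assumes "op_eq M A A'" "op_eq M B B'" "bounded_op M A" "bounded_op M B" "bounded_op M A'" "bounded_op M B'"
  shows "op_le M A B \<longleftrightarrow> op_le M A' B'"
  using l2_inner_op_eq[OF assms(1,3,5)] l2_inner_op_eq[OF assms(2,4,6)] by (simp add: op_le_def)

section \<open>Conditional expectations of complex functions\<close>

lemma borel_measurable_cE [measurable]:
  "cE M F f \<in> borel_measurable F" "cE M F f \<in> borel_measurable M"
  unfolding cE_def by measurable

lemma Re_cE: "Re (cE M F f x) = real_cond_exp M F (\<lambda>y. Re (f y)) x"
  and Im_cE: "Im (cE M F f x) = real_cond_exp M F (\<lambda>y. Im (f y)) x"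
  by (simp_all add: cE_def)

lemma real_cond_exp_uminus: "real_cond_exp M F (\<lambda>x. - f x) x = - real_cond_exp M F f x"
  by (simp add: real_cond_exp_def)

lemma cE_cnj: "cE M F (\<lambda>x. cnj (f x)) x = cnj (cE M F f x)"
  by (simp add: complex_eq_iff Re_cE Im_cE real_cond_exp_uminus)

lemma cE_imaginary_unit: "cE M F (\<lambda>x. \<i> * f x) x = \<i> * cE M F f x"
  by (simp add: complex_eq_iff Re_cE Im_cE real_cond_exp_uminus)

section \<open>Rules for E on D(E) over a sigma-finite subalgebra\<close>

context sigma_finite_subalgebra
begin

lemma F_meas_imp_M_meas: "f \<in> borel_measurable F \<Longrightarrow> f \<in> borel_measurable M"
  by (rule measurable_from_subalg[OF subalg])

lemma space_F: "space F = space M"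
  using subalg by (simp add: subalgebra_def)

lemma sets_F: "A \<in> sets F \<Longrightarrow> A \<in> sets M"
  using subalg by (auto simp: subalgebra_def)

lemma F_finite_exhaustion:
  obtains A :: "nat \<Rightarrow> 'a set"
  where "\<And>i. A i \<in> sets F" "(\<Union>i. A i) = space M" "\<And>i. emeasure M (A i) < \<infinity>"
proof -
  interpret R: sigma_finite_measure "restr_to_subalg M F" by (rule sigma_fin_subalg)
  obtain A :: "nat \<Rightarrow> 'a set" where A: "range A \<subseteq> sets (restr_to_subalg M F)"
    "(\<Union>i. A i) = space (restr_to_subalg M F)" "\<And>i. emeasure (restr_to_subalg M F) (A i) \<noteq> \<infinity>"
    by (rule R.sigma_finite) blast
  show thesis
    by (rule that[of A])
      (use A emeasure_restr_to_subalg[OF subalg] in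
        \<open>auto simp: sets_restr_to_subalg[OF subalg] space_restr_to_subalg less_top image_subset_iff\<close>)
qed

text \<open>The exceptional set is cut into countably many pieces in F, each of finite measure and
  with g bounded on it, so that every piece is an admissible test set.\<close>

lemma AE_le_if_set_nn_integral_le:
  fixes f g :: "'a \<Rightarrow> ennreal"
  assumes f [measurable]: "f \<in> borel_measurable F" and g [measurable]: "g \<in> borel_measurable F"
    and fin: "AE x in M. g x < \<infinity>"
    and le: "\<And>A. A \<in> sets F \<Longrightarrow> emeasure M A < \<infinity> \<Longrightarrow> (\<integral>\<^sup>+x\<in>A. f x \<partial>M) \<le> (\<integral>\<^sup>+x\<in>A. g x \<partial>M)"
  shows "AE x in M. f x \<le> g x"
proof -
  note [measurable] = F_meas_imp_M_meas[OF f] F_meas_imp_M_meas[OF g]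
  obtain A :: "nat \<Rightarrow> 'a set" where A: "\<And>i. A i \<in> sets F" "(\<Union>i. A i) = space M" "\<And>i. emeasure M (A i) < \<infinity>"
    by (rule F_finite_exhaustion) blast
  have main: "AE x in M. x \<in> A i \<longrightarrow> g x \<le> of_nat n \<longrightarrow> f x \<le> g x" for i n
  proof -
    \<comment> \<open>The cap n makes the integral of g over B finite; without it the subtraction of
      extended integrals below would be meaningless.\<close>
    define B where "B = {x\<in>space F. g x < f x \<and> g x \<le> of_nat n} \<inter> A i"
    have BF: "B \<in> sets F" unfolding B_def using A(1) by measurable
    have [measurable]: "B \<in> sets M" by (rule sets_F[OF BF])
    have Bfin: "emeasure M B < \<infinity>"
      using emeasure_mono[of B "A i" M] A(3)[of i] sets_F[OF A(1)] by (auto simp: B_def intro: le_less_trans)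
    have "(\<integral>\<^sup>+x\<in>B. g x \<partial>M) \<le> (\<integral>\<^sup>+x. of_nat n * indicator B x \<partial>M)"
      by (intro nn_integral_mono) (auto simp: B_def indicator_def)
    also have "\<dots> = of_nat n * emeasure M B" by (simp add: nn_integral_cmult_indicator)
    also have "\<dots> < \<infinity>" using Bfin by (simp add: ennreal_mult_less_top of_nat_less_top)
    finally have gfin: "(\<integral>\<^sup>+x\<in>B. g x \<partial>M) \<noteq> \<infinity>" by simp
    have "(\<integral>\<^sup>+x. (f x * indicator B x - g x * indicator B x) \<partial>M)
        = (\<integral>\<^sup>+x\<in>B. f x \<partial>M) - (\<integral>\<^sup>+x\<in>B. g x \<partial>M)"
    proof (rule nn_integral_diff)
      show "AE x in M. g x * indicator B x \<le> f x * indicator B x"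
        by (auto simp: B_def indicator_def)
    qed (use gfin in measurable)
    also have "\<dots> = 0"
      using le[OF BF Bfin] gfin by (simp add: diff_eq_0_iff_ennreal less_top)
    finally have "AE x in M. f x * indicator B x - g x * indicator B x = 0"
      by (subst (asm) nn_integral_0_iff_AE) auto
    then show ?thesis
      using AE_space
    proof eventually_elim
      case (elim x)
      show ?case
      proof (intro impI, rule ccontr)
        assume x: "x \<in> A i" "g x \<le> of_nat n" "\<not> f x \<le> g x"
        then have "x \<in> B" using elim(2) by (auto simp: B_def space_F)
        with elim(1) x(3) show False by (simp add: diff_eq_0_iff_ennreal)
      qed
    qed
  qed
  have "AE x in M. \<forall>i n. x \<in> A i \<longrightarrow> g x \<le> of_nat n \<longrightarrow> f x \<le> g x"
    unfolding AE_all_countable using main by blast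
  with fin AE_space show ?thesis
  proof eventually_elim
    case (elim x)
    obtain i where "x \<in> A i" using elim A(2) by blast
    moreover obtain n :: nat where "g x < of_nat n" using elim ennreal_Ex_less_of_nat by (auto simp: less_top)
    ultimately show ?case using elim by (meson less_imp_le)
  qed
qed

text \<open>Sigma-finiteness of the restriction of the measure to F, rather than of M alone, allows
  the function to be F-measurable.\<close>

lemma obtain_positive_integrable:
  obtains \<phi> :: "'a \<Rightarrow> real" where "\<phi> \<in> borel_measurable F" "\<And>x. x \<in> space M \<Longrightarrow> 0 < \<phi> x" "integrable M \<phi>"
proof -
  interpret R: sigma_finite_measure "restr_to_subalg M F" by (rule sigma_fin_subalg)
  obtain h where h: "h \<in> borel_measurable (restr_to_subalg M F)" "(\<integral>\<^sup>+x. h x \<partial>restr_to_subalg M F) \<noteq> \<infinity>"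
    "\<And>x. x \<in> space M \<Longrightarrow> 0 < h x \<and> h x < \<infinity>"
    using R.Ex_finite_integrable_function by (auto simp: space_restr_to_subalg)
  have hF [measurable]: "h \<in> borel_measurable F" by (rule measurable_in_subalg'[OF subalg h(1)])
  note [measurable] = F_meas_imp_M_meas[OF hF]
  have "(\<integral>\<^sup>+x. ennreal (enn2real (h x)) \<partial>M) = (\<integral>\<^sup>+x. h x \<partial>M)"
    by (rule nn_integral_cong) (use h(3) in auto)
  also have "\<dots> < \<infinity>" using h(2) nn_integral_subalgebra2[OF subalg hF] by (simp add: less_top)
  finally have "integrable M (\<lambda>x. enn2real (h x))" by (intro integrableI_nonneg) auto
  then show thesis
    using that[of "\<lambda>x. enn2real (h x)"] h(3) by (simp add: enn2real_positive_iff)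
qed

text \<open>The positive part of c h is c+ h+ plus c- h-, and nonnegative F-measurable factors may
  be pulled out of \<open>nn_cond_exp\<close> without integrability. At each point c+ or c- is 0, so
  \<open>enn2real\<close> meets a single product; infinite values then become 0 consistently on both
  sides.\<close>

lemma real_cond_exp_mult_measurable:
  fixes c g :: "'a \<Rightarrow> real"
  assumes c [measurable]: "c \<in> borel_measurable F" and [measurable]: "g \<in> borel_measurable M"
  shows "AE x in M. real_cond_exp M F (\<lambda>x. c x * g x) x = c x * real_cond_exp M F g x"
proof -
  note [measurable] = F_meas_imp_M_meas[OF c]
  let ?N = "nn_cond_exp M F"
  have pt: "AE x in M. ?N (\<lambda>x. ennreal (c x * h x)) x
      = ennreal (c x) * ?N (\<lambda>x. ennreal (h x)) x + ennreal (- c x) * ?N (\<lambda>x. ennreal (- h x)) x"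
    if [measurable]: "h \<in> borel_measurable M" for h
  proof -
    have eq: "(\<lambda>x. ennreal (c x * h x)) = (\<lambda>x. ennreal (c x) * ennreal (h x) + ennreal (- c x) * ennreal (- h x))"
    proof
      fix x show "ennreal (c x * h x) = ennreal (c x) * ennreal (h x) + ennreal (- c x) * ennreal (- h x)"
      proof (cases "0 \<le> c x")
        case True
        then show ?thesis by (cases "0 \<le> h x") (auto simp: ennreal_mult ennreal_neg mult_nonneg_nonpos)
      next
        case False
        then have "ennreal (c x * h x) = ennreal ((- c x) * (- h x))" "ennreal (c x) = 0" by (simp_all add: ennreal_neg)
        then show ?thesis
          using False ennreal_mult[of "- c x" "- h x"]
          by (cases "0 \<le> h x") (auto simp: ennreal_neg mult_nonpos_nonneg mult_nonneg_nonpos)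
      qed
    qed
    have "AE x in M. ?N (\<lambda>x. ennreal (c x) * ennreal (h x)) x + ?N (\<lambda>x. ennreal (- c x) * ennreal (- h x)) x
        = ?N (\<lambda>x. ennreal (c x) * ennreal (h x) + ennreal (- c x) * ennreal (- h x)) x"
      by (rule nn_cond_exp_sum) measurable
    moreover have "AE x in M. ennreal (c x) * ?N (\<lambda>x. ennreal (h x)) x = ?N (\<lambda>x. ennreal (c x) * ennreal (h x)) x"
      by (rule nn_cond_exp_prod) measurable
    moreover have "AE x in M. ennreal (- c x) * ?N (\<lambda>x. ennreal (- h x)) x = ?N (\<lambda>x. ennreal (- c x) * ennreal (- h x)) x"
      by (rule nn_cond_exp_prod) measurable
    ultimately show ?thesis unfolding eq by eventually_elim simp
  qed
  have "AE x in M. ?N (\<lambda>x. ennreal (c x * - g x)) x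
      = ennreal (c x) * ?N (\<lambda>x. ennreal (- g x)) x + ennreal (- c x) * ?N (\<lambda>x. ennreal (- (- g x))) x"
    by (rule pt) measurable
  with pt[of g, OF assms(2)] show ?thesis
  proof (eventually_elim)
    case (elim x)
    then show ?case
      by (cases "0 \<le> c x") (simp_all add: real_cond_exp_def enn2real_mult ennreal_neg algebra_simps)
  qed
qed

lemma cE_cong:
  assumes ae: "AE x in M. f x = g x" and [measurable]: "f \<in> borel_measurable M" "g \<in> borel_measurable M"
  shows "AE x in M. cE M F f x = cE M F g x"
proof -
  have "AE x in M. real_cond_exp M F (\<lambda>x. Re (f x)) x = real_cond_exp M F (\<lambda>x. Re (g x)) x"
       "AE x in M. real_cond_exp M F (\<lambda>x. Im (f x)) x = real_cond_exp M F (\<lambda>x. Im (g x)) x"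
    by (rule real_cond_exp_cong; use ae in auto)+
  then show ?thesis unfolding cE_def by eventually_elim simp
qed

lemma cE_mult_real:
  fixes c :: "'a \<Rightarrow> real"
  assumes [measurable]: "c \<in> borel_measurable F" "g \<in> borel_measurable M"
  shows "AE x in M. cE M F (\<lambda>x. of_real (c x) * g x) x = of_real (c x) * cE M F g x"
proof -
  have "AE x in M. real_cond_exp M F (\<lambda>x. c x * Re (g x)) x = c x * real_cond_exp M F (\<lambda>x. Re (g x)) x"
       "AE x in M. real_cond_exp M F (\<lambda>x. c x * Im (g x)) x = c x * real_cond_exp M F (\<lambda>x. Im (g x)) x"
    by (rule real_cond_exp_mult_measurable; measurable)+
  then show ?thesis by eventually_elim (simp add: complex_eq_iff Re_cE Im_cE)
qed

lemma DE_meas: "g \<in> DE M F \<Longrightarrow> g \<in> borel_measurable M"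
  by (simp add: DE_def)

lemma DE_finite: "g \<in> DE M F \<Longrightarrow> AE x in M. nn_cond_exp M F (\<lambda>x. ennreal (cmod (g x))) x < \<infinity>"
  by (simp add: DE_def)

lemma DE_mult:
  assumes c [measurable]: "c \<in> borel_measurable F" and g: "g \<in> DE M F"
  shows "(\<lambda>x. c x * g x) \<in> DE M F"
proof -
  note [measurable] = F_meas_imp_M_meas[OF c] DE_meas[OF g]
  have "AE x in M. ennreal (cmod (c x)) * nn_cond_exp M F (\<lambda>x. ennreal (cmod (g x))) x
     = nn_cond_exp M F (\<lambda>x. ennreal (cmod (c x)) * ennreal (cmod (g x))) x"
    by (rule nn_cond_exp_prod) measurable
  then have "AE x in M. nn_cond_exp M F (\<lambda>x. ennreal (cmod (c x * g x))) x < \<infinity>"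
    using DE_finite[OF g]
  proof eventually_elim
    case (elim x)
    have "ennreal (cmod (c x)) * nn_cond_exp M F (\<lambda>x. ennreal (cmod (g x))) x < \<infinity>"
      using elim(2) by (simp add: ennreal_mult_less_top)
    then show ?case by (simp add: elim(1) norm_mult ennreal_mult)
  qed
  then show ?thesis by (simp add: DE_def)
qed

text \<open>Dividing a positive integrable F-measurable function by 1 + E(|g|) + E(|h|) works: the
  integral of \<rho> |g| equals that of \<rho> E(|g|). The weight transports facts about integrable
  functions to D(E).\<close>

lemma DE_integrable_weight:
  assumes g: "g \<in> DE M F" and h: "h \<in> DE M F"
  obtains \<rho> :: "'a \<Rightarrow> real" where "\<rho> \<in> borel_measurable F" "\<And>x. x \<in> space M \<Longrightarrow> 0 < \<rho> x"
    "integrable M (\<lambda>x. of_real (\<rho> x) * g x)" "integrable M (\<lambda>x. of_real (\<rho> x) * h x)"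
proof -
  note [measurable] = DE_meas[OF g] DE_meas[OF h]
  obtain \<phi> :: "'a \<Rightarrow> real" where \<phi> [measurable]: "\<phi> \<in> borel_measurable F"
    and pos: "\<And>x. x \<in> space M \<Longrightarrow> 0 < \<phi> x" and int: "integrable M \<phi>"
    by (rule obtain_positive_integrable) blast
  note [measurable] = F_meas_imp_M_meas[OF \<phi>]
  let ?N = "\<lambda>g. nn_cond_exp M F (\<lambda>x. ennreal (cmod (g x)))"
  \<comment> \<open>The summand 1 keeps the denominator positive even where both expectations vanish
    or are infinite, in which case \<open>enn2real\<close> returns 0.\<close>
  define \<rho> where "\<rho> x = \<phi> x / (1 + enn2real (?N g x) + enn2real (?N h x))" for x
  have \<rho> [measurable]: "\<rho> \<in> borel_measurable F" unfolding \<rho>_def by measurable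
  note [measurable] = F_meas_imp_M_meas[OF \<rho>]
  have \<rho>pos: "0 < \<rho> x" if "x \<in> space M" for x
    using pos[OF that] by (simp add: \<rho>_def add_pos_nonneg)
  have "integrable M (\<lambda>x. of_real (\<rho> x) * k x)" if k: "k \<in> DE M F" "k = g \<or> k = h" for k
  proof -
    have [measurable]: "k \<in> borel_measurable M" using k by (simp add: DE_meas)
    have "(\<integral>\<^sup>+x. ennreal (cmod (of_real (\<rho> x) * k x)) \<partial>M) = (\<integral>\<^sup>+x. ennreal (\<rho> x) * ennreal (cmod (k x)) \<partial>M)"
      by (rule nn_integral_cong) (use \<rho>pos in \<open>simp add: norm_mult ennreal_mult less_imp_le\<close>)
    also have "\<dots> = (\<integral>\<^sup>+x. ennreal (\<rho> x) * ?N k x \<partial>M)" by (rule nn_cond_exp_intg[symmetric]) measurable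
    also have "\<dots> \<le> (\<integral>\<^sup>+x. ennreal (\<phi> x) \<partial>M)"
    proof (rule nn_integral_mono_AE)
      show "AE x in M. ennreal (\<rho> x) * ?N k x \<le> ennreal (\<phi> x)"
        using DE_finite[OF k(1)] AE_space
      proof eventually_elim
        case (elim x)
        then obtain r where r: "r \<ge> 0" "?N k x = ennreal r" by (cases "?N k x") auto
        have "\<rho> x * r \<le> \<phi> x"
        proof -
          have "r \<le> 1 + enn2real (?N g x) + enn2real (?N h x)"
            using k(2) r enn2real_nonneg[of "?N g x"] enn2real_nonneg[of "?N h x"] by (elim disjE; simp)
          moreover have "0 < 1 + enn2real (?N g x) + enn2real (?N h x)" by (simp add: add_pos_nonneg)
          ultimately show ?thesis
            using mult_left_mono[of r _ "\<phi> x"] pos[OF elim(2)] by (simp add: \<rho>_def pos_divide_le_eq)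
        qed
        then show ?case
          unfolding r(2) using r(1) \<rho>pos[OF elim(2)] by (subst ennreal_mult[symmetric]) (auto intro: ennreal_leI)
      qed
    qed
    also have "\<dots> < \<infinity>"
      using int pos by (subst nn_integral_eq_integral) (auto simp: less_imp_le)
    finally show ?thesis by (intro integrableI_bounded) auto
  qed
  then show thesis using that[of \<rho>] \<rho>pos g h by simp
qed

lemma cE_add_integrable:
  assumes "integrable M f" "integrable M g"
  shows "AE x in M. cE M F (\<lambda>x. f x + g x) x = cE M F f x + cE M F g x"
proof -
  have "AE x in M. real_cond_exp M F (\<lambda>x. Re (f x) + Re (g x)) x
      = real_cond_exp M F (\<lambda>x. Re (f x)) x + real_cond_exp M F (\<lambda>x. Re (g x)) x"
    "AE x in M. real_cond_exp M F (\<lambda>x. Im (f x) + Im (g x)) x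
      = real_cond_exp M F (\<lambda>x. Im (f x)) x + real_cond_exp M F (\<lambda>x. Im (g x)) x"
    using assms by (auto intro!: real_cond_exp_add)
  then show ?thesis by eventually_elim (simp add: complex_eq_iff Re_cE Im_cE)
qed

text \<open>After multiplication by the positive weight \<rho> both summands are integrable; \<rho>
  is F-measurable, so it leaves E and cancels.\<close>

lemma cE_add:
  assumes f: "f \<in> DE M F" and g: "g \<in> DE M F"
  shows "AE x in M. cE M F (\<lambda>x. f x + g x) x = cE M F f x + cE M F g x"
proof -
  note [measurable] = DE_meas[OF f] DE_meas[OF g]
  obtain \<rho> :: "'a \<Rightarrow> real" where \<rho> [measurable]: "\<rho> \<in> borel_measurable F" and pos: "\<And>x. x \<in> space M \<Longrightarrow> 0 < \<rho> x"
    and int: "integrable M (\<lambda>x. of_real (\<rho> x) * f x)" "integrable M (\<lambda>x. of_real (\<rho> x) * g x)"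
    by (rule DE_integrable_weight[OF f g]) blast
  have "AE x in M. cE M F (\<lambda>x. of_real (\<rho> x) * (f x + g x)) x = of_real (\<rho> x) * cE M F (\<lambda>x. f x + g x) x"
    "AE x in M. cE M F (\<lambda>x. of_real (\<rho> x) * f x) x = of_real (\<rho> x) * cE M F f x"
    "AE x in M. cE M F (\<lambda>x. of_real (\<rho> x) * g x) x = of_real (\<rho> x) * cE M F g x"
    by (intro cE_mult_real; measurable)+
  then show ?thesis
    using cE_add_integrable[OF int] AE_space
  proof eventually_elim
    case (elim x)
    then have "of_real (\<rho> x) * cE M F (\<lambda>x. f x + g x) x = of_real (\<rho> x) * (cE M F f x + cE M F g x)"
      by (simp add: distrib_left)
    then show ?case using pos[OF elim(5)] by simp
  qed
qed

text \<open>Splitting c into real and imaginary part gives real multiples of g and of i g.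
  Additivity of E is then needed, which is why g is taken from D(E), unlike for real
  factors.\<close>

lemma cE_mult:
  assumes c [measurable]: "c \<in> borel_measurable F" and g: "g \<in> DE M F"
  shows "AE x in M. cE M F (\<lambda>x. c x * g x) x = c x * cE M F g x"
proof -
  note [measurable] = DE_meas[OF g]
  have ig: "(\<lambda>x. \<i> * g x) \<in> DE M F" by (intro DE_mult g) measurable
  have "AE x in M. cE M F (\<lambda>x. of_real (Re (c x)) * g x + of_real (Im (c x)) * (\<i> * g x)) x
      = cE M F (\<lambda>x. of_real (Re (c x)) * g x) x + cE M F (\<lambda>x. of_real (Im (c x)) * (\<i> * g x)) x"
    by (intro cE_add DE_mult g ig) measurable
  moreover have "AE x in M. cE M F (\<lambda>x. of_real (Re (c x)) * g x) x = of_real (Re (c x)) * cE M F g x"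
    "AE x in M. cE M F (\<lambda>x. of_real (Im (c x)) * (\<i> * g x)) x = of_real (Im (c x)) * cE M F (\<lambda>x. \<i> * g x) x"
    by (intro cE_mult_real; measurable)+
  moreover have "(\<lambda>x. c x * g x) = (\<lambda>x. of_real (Re (c x)) * g x + of_real (Im (c x)) * (\<i> * g x))"
    by (simp add: complex_eq_iff fun_eq_iff)
  ultimately show ?thesis
    unfolding cE_imaginary_unit by (auto simp: complex_eq_iff elim!: eventually_elim2)
qed

text \<open>Real and imaginary part are bounded separately, which costs the factor 2. It affects
  only norm bounds, never the identities between operators.\<close>

lemma cE_cmod_le:
  assumes [measurable]: "g \<in> borel_measurable M"
  shows "AE x in M. ennreal (cmod (cE M F g x)) \<le> 2 * nn_cond_exp M F (\<lambda>x. ennreal (cmod (g x))) x"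
proof -
  have "AE x in M. ennreal \<bar>real_cond_exp M F (\<lambda>x. Re (g x)) x\<bar> \<le> nn_cond_exp M F (\<lambda>x. ennreal \<bar>Re (g x)\<bar>) x"
    "AE x in M. ennreal \<bar>real_cond_exp M F (\<lambda>x. Im (g x)) x\<bar> \<le> nn_cond_exp M F (\<lambda>x. ennreal \<bar>Im (g x)\<bar>) x"
    by (rule real_cond_exp_abs; measurable)+
  moreover have "AE x in M. nn_cond_exp M F (\<lambda>x. ennreal \<bar>Re (g x)\<bar>) x \<le> nn_cond_exp M F (\<lambda>x. ennreal (cmod (g x))) x"
    "AE x in M. nn_cond_exp M F (\<lambda>x. ennreal \<bar>Im (g x)\<bar>) x \<le> nn_cond_exp M F (\<lambda>x. ennreal (cmod (g x))) x"
    by (intro nn_cond_exp_mono AE_I2 ennreal_leI abs_Re_le_cmod abs_Im_le_cmod; measurable)+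
  ultimately show ?thesis
  proof eventually_elim
    case (elim x)
    have "ennreal (cmod (cE M F g x))
        \<le> ennreal \<bar>real_cond_exp M F (\<lambda>x. Re (g x)) x\<bar> + ennreal \<bar>real_cond_exp M F (\<lambda>x. Im (g x)) x\<bar>"
      using cmod_le[of "cE M F g x"] by (simp add: Re_cE Im_cE ennreal_leI flip: ennreal_plus)
    also have "\<dots> \<le> nn_cond_exp M F (\<lambda>x. ennreal (cmod (g x))) x + nn_cond_exp M F (\<lambda>x. ennreal (cmod (g x))) x"
      by (intro add_mono order_trans[OF elim(1) elim(3)] order_trans[OF elim(2) elim(4)])
    finally show ?case by (simp add: mult_2)
  qed
qed

lemma cE_intg:
  assumes h [measurable]: "h \<in> borel_measurable F" and g: "g \<in> DE M F" and int: "integrable M (\<lambda>x. h x * g x)"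
  shows "(LINT x|M. h x * cE M F g x) = (LINT x|M. h x * g x)"
proof -
  note [measurable] = F_meas_imp_M_meas[OF h] DE_meas[OF g]
  let ?G = "\<lambda>x. h x * g x"
  have re: "integrable M (real_cond_exp M F (\<lambda>x. Re (?G x)))" "(LINT x|M. real_cond_exp M F (\<lambda>x. Re (?G x)) x) = (LINT x|M. Re (?G x))"
    by (intro real_cond_exp_int integrable_Re int)+
  have im: "integrable M (real_cond_exp M F (\<lambda>x. Im (?G x)))" "(LINT x|M. real_cond_exp M F (\<lambda>x. Im (?G x)) x) = (LINT x|M. Im (?G x))"
    by (intro real_cond_exp_int integrable_Im int)+
  have "(LINT x|M. h x * cE M F g x) = (LINT x|M. cE M F ?G x)"
    by (rule integral_cong_AE) (use cE_mult[OF h g] in auto)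
  also have "\<dots> = (LINT x|M. complex_of_real (real_cond_exp M F (\<lambda>x. Re (?G x)) x))
      + \<i> * (LINT x|M. complex_of_real (real_cond_exp M F (\<lambda>x. Im (?G x)) x))"
    unfolding cE_def using re(1) im(1) by (subst Bochner_Integration.integral_add) auto
  also have "\<dots> = (LINT x|M. ?G x)"
    using int re(2) im(2) by (simp only: integral_complex_of_real) (simp add: complex_eq_iff flip: integral_Re integral_Im)
  finally show ?thesis .
qed

lemma L2_finite_cond_exp:
  assumes f: "f \<in> L2 M"
  shows "AE x in M. nn_cond_exp M F (\<lambda>x. ennreal ((cmod (f x))\<^sup>2)) x < \<infinity>"
proof -
  note [measurable] = L2_D(1)[OF f]
  have "(\<integral>\<^sup>+x. nn_cond_exp M F (\<lambda>x. ennreal ((cmod (f x))\<^sup>2)) x \<partial>M) = (\<integral>\<^sup>+x. ennreal ((cmod (f x))\<^sup>2) \<partial>M)"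
    using nn_cond_exp_intg[of "\<lambda>x. 1" "\<lambda>x. ennreal ((cmod (f x))\<^sup>2)"] by simp
  also have "\<dots> \<noteq> \<infinity>" using L2_D(2)[OF f] by (subst nn_integral_eq_integral) auto
  finally show ?thesis
    using nn_integral_PInf_AE[of "nn_cond_exp M F (\<lambda>x. ennreal ((cmod (f x))\<^sup>2))" M] by (simp add: less_top)
qed

section \<open>Weighted conditional expectation operators\<close>

text \<open>The condition E(|a|^2) \<le> 1 makes f \<mapsto> E(a f) bounded on L2 and multiplication
  by a contractive on the F-measurable part of L2, although a itself may be unbounded.\<close>

definition cond_contraction :: "('a \<Rightarrow> complex) \<Rightarrow> bool" where
  "cond_contraction a \<longleftrightarrow> a \<in> borel_measurable M \<and>
     (AE x in M. nn_cond_exp M F (\<lambda>x. ennreal ((cmod (a x))\<^sup>2)) x \<le> 1)"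

lemma cond_contraction_meas: "cond_contraction a \<Longrightarrow> a \<in> borel_measurable M"
  by (simp add: cond_contraction_def)

lemma cond_contraction_cnj: "cond_contraction a \<Longrightarrow> cond_contraction (\<lambda>x. cnj (a x))"
  by (simp add: cond_contraction_def borel_measurable_cnj)

text \<open>The inequality 2 t |a f| \<le> t^2 |a|^2 + |f|^2 is conditioned with an F-measurable t,
  which may be chosen after E(|a f|) is known.\<close>

lemma cond_Cauchy_Schwarz:
  assumes a: "cond_contraction a" and f [measurable]: "f \<in> borel_measurable M"
    and fin: "AE x in M. nn_cond_exp M F (\<lambda>x. ennreal ((cmod (f x))\<^sup>2)) x < \<infinity>"
  shows "(\<lambda>x. a x * f x) \<in> DE M F"
    and "AE x in M. (nn_cond_exp M F (\<lambda>x. ennreal (cmod (a x * f x))) x)\<^sup>2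
      \<le> nn_cond_exp M F (\<lambda>x. ennreal ((cmod (f x))\<^sup>2)) x"
proof -
  note [measurable] = cond_contraction_meas[OF a]
  let ?N = "nn_cond_exp M F"
  let ?A = "?N (\<lambda>x. ennreal ((cmod (a x))\<^sup>2))" and ?F = "?N (\<lambda>x. ennreal ((cmod (f x))\<^sup>2))"
    and ?H = "?N (\<lambda>x. ennreal (cmod (a x * f x)))"
  have A: "AE x in M. ?A x \<le> 1" using a by (simp add: cond_contraction_def)
  have ineq: "AE x in M. ennreal (2 * t x) * ?H x \<le> ennreal ((t x)\<^sup>2) * ?A x + ?F x"
    if t [measurable]: "t \<in> borel_measurable F" and t0: "\<And>x. 0 \<le> t x" for t
  proof -
    note [measurable] = F_meas_imp_M_meas[OF t]
    have "AE x in M. ?N (\<lambda>x. ennreal (2 * t x) * ennreal (cmod (a x * f x))) x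
        \<le> ?N (\<lambda>x. ennreal ((t x)\<^sup>2) * ennreal ((cmod (a x))\<^sup>2) + ennreal ((cmod (f x))\<^sup>2)) x"
    proof (intro nn_cond_exp_mono AE_I2)
      fix x
      have "2 * (t x * cmod (a x)) * cmod (f x) \<le> (t x * cmod (a x))\<^sup>2 + (cmod (f x))\<^sup>2"
        by (rule sum_squares_bound)
      then show "ennreal (2 * t x) * ennreal (cmod (a x * f x)) \<le> ennreal ((t x)\<^sup>2) * ennreal ((cmod (a x))\<^sup>2) + ennreal ((cmod (f x))\<^sup>2)"
        using t0[of x] by (simp add: norm_mult power_mult_distrib mult.assoc ennreal_leI flip: ennreal_mult ennreal_plus)
    qed measurable
    moreover have "AE x in M. ennreal (2 * t x) * ?H x = ?N (\<lambda>x. ennreal (2 * t x) * ennreal (cmod (a x * f x))) x"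
      by (rule nn_cond_exp_prod) measurable
    moreover have "AE x in M. ennreal ((t x)\<^sup>2) * ?A x = ?N (\<lambda>x. ennreal ((t x)\<^sup>2) * ennreal ((cmod (a x))\<^sup>2)) x"
      by (rule nn_cond_exp_prod) measurable
    moreover have "AE x in M. ?N (\<lambda>x. ennreal ((t x)\<^sup>2) * ennreal ((cmod (a x))\<^sup>2)) x + ?F x
        = ?N (\<lambda>x. ennreal ((t x)\<^sup>2) * ennreal ((cmod (a x))\<^sup>2) + ennreal ((cmod (f x))\<^sup>2)) x"
      by (rule nn_cond_exp_sum) measurable
    ultimately show ?thesis by eventually_elim simp
  qed
  \<comment> \<open>The choice t = 1/2 gives E(|a f|) the coefficient 1 and already yields
    finiteness.\<close>
  have Hfin: "AE x in M. ?H x < \<infinity>"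
    using ineq[of "\<lambda>x. 1/2", OF borel_measurable_const, simplified] A fin
  proof eventually_elim
    case (elim x)
    have "?H x \<le> ennreal ((1/2)\<^sup>2) * ?A x + ?F x" using elim(1) by (simp add: power2_eq_square)
    also have "\<dots> < \<infinity>" using elim(2,3) by (auto simp: ennreal_mult_less_top intro: le_less_trans)
    finally show ?case .
  qed
  then show "(\<lambda>x. a x * f x) \<in> DE M F" by (simp add: DE_def)
  \<comment> \<open>Taking t = E(|a f|) = h turns the inequality into 2 h^2 \<le> h^2 +
    E(|f|^2).\<close>
  have "AE x in M. ennreal (2 * enn2real (?H x)) * ?H x \<le> ennreal ((enn2real (?H x))\<^sup>2) * ?A x + ?F x"
    by (rule ineq) simp_all
  then show "AE x in M. (?H x)\<^sup>2 \<le> ?F x"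
    using A Hfin fin
  proof eventually_elim
    case (elim x)
    obtain h where h: "?H x = ennreal h" "0 \<le> h" using elim(3) by (cases "?H x") auto
    obtain r where r: "?F x = ennreal r" "0 \<le> r" using elim(4) by (cases "?F x") auto
    have "ennreal (2 * h * h) \<le> ennreal (h\<^sup>2) * ?A x + ennreal r"
      using elim(1) h r by (simp add: ennreal_mult)
    also have "\<dots> \<le> ennreal (h\<^sup>2) * 1 + ennreal r" by (intro add_mono mult_left_mono elim(2)) auto
    also have "\<dots> = ennreal (h\<^sup>2 + r)" using r(2) by simp
    finally have "2 * h * h \<le> h\<^sup>2 + r" using r(2) by (subst (asm) ennreal_le_iff) auto
    then have "h\<^sup>2 \<le> r" by (simp add: power2_eq_square)
    then show ?case using h r by (simp add: ennreal_power ennreal_leI)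
  qed
qed

lemma cond_contraction_DE:
  assumes a: "cond_contraction a" and f: "f \<in> L2 M"
  shows "(\<lambda>x. a x * f x) \<in> DE M F"
  by (rule cond_Cauchy_Schwarz[OF a L2_D(1)[OF f] L2_finite_cond_exp[OF f]])

lemma cond_contraction_mult_bound:
  assumes a: "cond_contraction a" and b: "cond_contraction b"
  shows "(\<lambda>x. a x * b x) \<in> DE M F" "AE x in M. cmod (cE M F (\<lambda>x. a x * b x) x) \<le> 2"
proof -
  note [measurable] = cond_contraction_meas[OF a] cond_contraction_meas[OF b]
  have b1: "AE x in M. nn_cond_exp M F (\<lambda>x. ennreal ((cmod (b x))\<^sup>2)) x \<le> 1"
    using b by (simp add: cond_contraction_def)
  then have fin: "AE x in M. nn_cond_exp M F (\<lambda>x. ennreal ((cmod (b x))\<^sup>2)) x < \<infinity>"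
    by eventually_elim (auto intro: le_less_trans)
  show "(\<lambda>x. a x * b x) \<in> DE M F"
    by (rule cond_Cauchy_Schwarz[OF a _ fin]) measurable
  have "AE x in M. (nn_cond_exp M F (\<lambda>x. ennreal (cmod (a x * b x))) x)\<^sup>2
      \<le> nn_cond_exp M F (\<lambda>x. ennreal ((cmod (b x))\<^sup>2)) x"
    by (rule cond_Cauchy_Schwarz[OF a _ fin]) measurable
  moreover have "AE x in M. ennreal (cmod (cE M F (\<lambda>x. a x * b x) x)) \<le> 2 * nn_cond_exp M F (\<lambda>x. ennreal (cmod (a x * b x))) x"
    by (rule cE_cmod_le) measurable
  ultimately show "AE x in M. cmod (cE M F (\<lambda>x. a x * b x) x) \<le> 2"
    using b1
  proof eventually_elim
    case (elim x)
    define h where "h = nn_cond_exp M F (\<lambda>x. ennreal (cmod (a x * b x))) x"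
    have h2: "h\<^sup>2 \<le> 1" using elim(1,3) by (simp add: h_def)
    have "h \<le> 1"
    proof (cases h)
      case (real r)
      with h2 have "r\<^sup>2 \<le> 1" by (simp add: ennreal_power flip: ennreal_1)
      then have "r \<le> 1" using real power2_le_imp_le[of r 1] by simp
      then show ?thesis using real by simp
    qed (use h2 in \<open>simp add: power2_eq_square ennreal_top_mult\<close>)
    then have "2 * h \<le> 2 * 1" by (intro mult_left_mono) auto
    with elim(2) have "ennreal (cmod (cE M F (\<lambda>x. a x * b x) x)) \<le> ennreal 2"
      by (simp add: h_def)
    then show ?case by (subst (asm) ennreal_le_iff) auto
  qed
qed

lemma cE_contraction_L2:
  assumes a: "cond_contraction a" and f: "f \<in> L2 M"
  shows "cE M F (\<lambda>x. a x * f x) \<in> L2 M"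
    and "(LINT x|M. (cmod (cE M F (\<lambda>x. a x * f x) x))\<^sup>2) \<le> 4 * (LINT x|M. (cmod (f x))\<^sup>2)"
proof -
  note [measurable] = cond_contraction_meas[OF a] L2_D(1)[OF f]
  let ?G = "cE M F (\<lambda>x. a x * f x)"
  have ptw: "AE x in M. ennreal ((cmod (?G x))\<^sup>2) \<le> 4 * nn_cond_exp M F (\<lambda>x. ennreal ((cmod (f x))\<^sup>2)) x"
  proof -
    have "AE x in M. ennreal (cmod (?G x)) \<le> 2 * nn_cond_exp M F (\<lambda>x. ennreal (cmod (a x * f x))) x"
      by (rule cE_cmod_le) measurable
    moreover note cond_Cauchy_Schwarz(2)[OF a L2_D(1)[OF f] L2_finite_cond_exp[OF f]]
    ultimately show ?thesis
    proof eventually_elim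
      case (elim x)
      have "ennreal ((cmod (?G x))\<^sup>2) = (ennreal (cmod (?G x)))\<^sup>2" by (simp add: ennreal_power)
      also have "\<dots> \<le> (2 * nn_cond_exp M F (\<lambda>x. ennreal (cmod (a x * f x))) x)\<^sup>2"
        by (intro power_mono elim) simp
      also have "\<dots> = 4 * (nn_cond_exp M F (\<lambda>x. ennreal (cmod (a x * f x))) x)\<^sup>2" by (simp add: power_mult_distrib)
      also have "\<dots> \<le> 4 * nn_cond_exp M F (\<lambda>x. ennreal ((cmod (f x))\<^sup>2)) x" by (intro mult_left_mono elim) simp
      finally show ?case .
    qed
  qed
  have "(\<integral>\<^sup>+x. ennreal ((cmod (?G x))\<^sup>2) \<partial>M) \<le> (\<integral>\<^sup>+x. 4 * nn_cond_exp M F (\<lambda>x. ennreal ((cmod (f x))\<^sup>2)) x \<partial>M)"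
    by (rule nn_integral_mono_AE[OF ptw])
  also have "\<dots> = (\<integral>\<^sup>+x. 4 * ennreal ((cmod (f x))\<^sup>2) \<partial>M)" by (rule nn_cond_exp_intg) measurable
  also have "\<dots> = 4 * ennreal (LINT x|M. (cmod (f x))\<^sup>2)"
    using L2_D(2)[OF f] by (simp add: nn_integral_cmult nn_integral_eq_integral)
  also have "\<dots> = ennreal (4 * (LINT x|M. (cmod (f x))\<^sup>2))" by (simp add: ennreal_mult)
  finally have le: "(\<integral>\<^sup>+x. ennreal ((cmod (?G x))\<^sup>2) \<partial>M) \<le> ennreal (4 * (LINT x|M. (cmod (f x))\<^sup>2))" .
  then have int: "integrable M (\<lambda>x. (cmod (?G x))\<^sup>2)"
    by (intro integrableI_nonneg) (auto intro: le_less_trans)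
  then show "?G \<in> L2 M" by (simp add: L2_def)
  show "(LINT x|M. (cmod (?G x))\<^sup>2) \<le> 4 * (LINT x|M. (cmod (f x))\<^sup>2)"
    using le by (subst (asm) nn_integral_eq_integral[OF int]) (auto simp: ennreal_le_iff)
qed

text \<open>As g is F-measurable, |b|^2 may be replaced by E(|b|^2) \<le> 1 under the integral of
  |g|^2 |b|^2.\<close>

lemma L2_contraction_mult:
  assumes b: "cond_contraction b" and g: "g \<in> L2 M" and gF: "g \<in> borel_measurable F"
  shows "(\<lambda>x. b x * g x) \<in> L2 M"
    and "(LINT x|M. (cmod (b x * g x))\<^sup>2) \<le> (LINT x|M. (cmod (g x))\<^sup>2)"
proof -
  note [measurable] = cond_contraction_meas[OF b] L2_D(1)[OF g] gF
  have b1: "AE x in M. nn_cond_exp M F (\<lambda>x. ennreal ((cmod (b x))\<^sup>2)) x \<le> 1"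
    using b by (simp add: cond_contraction_def)
  have "(\<integral>\<^sup>+x. ennreal ((cmod (b x * g x))\<^sup>2) \<partial>M) = (\<integral>\<^sup>+x. ennreal ((cmod (g x))\<^sup>2) * ennreal ((cmod (b x))\<^sup>2) \<partial>M)"
    by (simp add: norm_mult power_mult_distrib ennreal_mult mult.commute)
  also have "\<dots> = (\<integral>\<^sup>+x. ennreal ((cmod (g x))\<^sup>2) * nn_cond_exp M F (\<lambda>x. ennreal ((cmod (b x))\<^sup>2)) x \<partial>M)"
    by (rule nn_cond_exp_intg[symmetric]) measurable
  also have "\<dots> \<le> (\<integral>\<^sup>+x. ennreal ((cmod (g x))\<^sup>2) \<partial>M)"
  proof (rule nn_integral_mono_AE)
    show "AE x in M. ennreal ((cmod (g x))\<^sup>2) * nn_cond_exp M F (\<lambda>x. ennreal ((cmod (b x))\<^sup>2)) x \<le> ennreal ((cmod (g x))\<^sup>2)"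
      using b1 by eventually_elim (use mult_left_mono in fastforce)
  qed
  also have "\<dots> = ennreal (LINT x|M. (cmod (g x))\<^sup>2)"
    using L2_D(2)[OF g] by (simp add: nn_integral_eq_integral)
  finally have le: "(\<integral>\<^sup>+x. ennreal ((cmod (b x * g x))\<^sup>2) \<partial>M) \<le> ennreal (LINT x|M. (cmod (g x))\<^sup>2)" .
  then have int: "integrable M (\<lambda>x. (cmod (b x * g x))\<^sup>2)"
    by (intro integrableI_nonneg) (auto intro: le_less_trans)
  then show "(\<lambda>x. b x * g x) \<in> L2 M" by (simp add: L2_def)
  show "(LINT x|M. (cmod (b x * g x))\<^sup>2) \<le> (LINT x|M. (cmod (g x))\<^sup>2)"
    using le by (subst (asm) nn_integral_eq_integral[OF int]) (auto simp: ennreal_le_iff)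
qed

section \<open>Bounded multipliers and operators of the form f \<mapsto> b m E(cnj a f)\<close>

definition bounded_multiplier :: "('a \<Rightarrow> complex) \<Rightarrow> bool" where
  "bounded_multiplier m \<longleftrightarrow> m \<in> borel_measurable F \<and> (\<exists>C. AE x in M. cmod (m x) \<le> C)"

lemma bounded_multiplier_meas: "bounded_multiplier m \<Longrightarrow> m \<in> borel_measurable F"
  by (simp add: bounded_multiplier_def)

lemma bounded_multiplier_cnj: "bounded_multiplier m \<Longrightarrow> bounded_multiplier (\<lambda>x. cnj (m x))"
  by (auto simp: bounded_multiplier_def)

lemma bounded_multiplier_mult:
  assumes "bounded_multiplier m" "bounded_multiplier n"
  shows "bounded_multiplier (\<lambda>x. m x * n x)"
proof -
  note [measurable] = assms[THEN bounded_multiplier_meas]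
  obtain C D where "AE x in M. cmod (m x) \<le> C" "AE x in M. cmod (n x) \<le> D"
    using assms by (auto simp: bounded_multiplier_def)
  then have "AE x in M. cmod (m x * n x) \<le> \<bar>C\<bar> * \<bar>D\<bar>"
    by eventually_elim (auto simp: norm_mult intro!: mult_mono)
  then show ?thesis unfolding bounded_multiplier_def by (intro conjI exI) measurable
qed

lemma bounded_multiplier_cmod:
  "bounded_multiplier m \<Longrightarrow> bounded_multiplier (\<lambda>x. of_real (cmod (m x)))"
  by (auto simp: bounded_multiplier_def)

lemma L2_bounded_multiplier:
  assumes m: "bounded_multiplier m"
  obtains K where "K \<ge> 0" "\<And>g. g \<in> L2 M \<Longrightarrow> (\<lambda>x. m x * g x) \<in> L2 M"
    "\<And>g. g \<in> L2 M \<Longrightarrow> (LINT x|M. (cmod (m x * g x))\<^sup>2) \<le> K * (LINT x|M. (cmod (g x))\<^sup>2)"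
proof -
  note [measurable] = bounded_multiplier_meas[OF m] F_meas_imp_M_meas[OF bounded_multiplier_meas[OF m]]
  obtain C where C: "AE x in M. cmod (m x) \<le> C"
    using m by (auto simp: bounded_multiplier_def)
  have *: "integrable M (\<lambda>x. (cmod (m x * g x))\<^sup>2) \<and>
      (LINT x|M. (cmod (m x * g x))\<^sup>2) \<le> C\<^sup>2 * (LINT x|M. (cmod (g x))\<^sup>2)" if g: "g \<in> L2 M" for g
  proof -
    note [measurable] = L2_D(1)[OF g]
    have le: "AE x in M. (cmod (m x * g x))\<^sup>2 \<le> C\<^sup>2 * (cmod (g x))\<^sup>2"
      using C by eventually_elim (auto simp: norm_mult power_mult_distrib intro!: mult_right_mono power_mono)
    have int: "integrable M (\<lambda>x. C\<^sup>2 * (cmod (g x))\<^sup>2)" using L2_D(2)[OF g] by simp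
    have int': "integrable M (\<lambda>x. (cmod (m x * g x))\<^sup>2)"
      by (rule Bochner_Integration.integrable_bound[OF int]) (use le in auto)
    then show ?thesis using integral_mono_AE[OF int' int le] by simp
  qed
  show thesis
    by (rule that[of "C\<^sup>2"])
      (use * in \<open>auto simp: L2_def borel_measurable_times[OF F_meas_imp_M_meas[OF bounded_multiplier_meas[OF m]]]\<close>)
qed

text \<open>This is the analogue of the rank-one operator f \<mapsto> m <f, a> b, with F-measurable
  functions as scalars. The conjugate on a is chosen so that taking adjoints exchanges a and b and
  conjugates m.\<close>

definition weighted_cond_op :: "('a \<Rightarrow> complex) \<Rightarrow> ('a \<Rightarrow> complex) \<Rightarrow> ('a \<Rightarrow> complex) \<Rightarrow> 'a op" where
  "weighted_cond_op m a b = (\<lambda>f x. b x * (m x * cE M F (\<lambda>y. cnj (a y) * f y) x))"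

context
  fixes m a b :: "'a \<Rightarrow> complex"
  assumes m: "bounded_multiplier m" and a: "cond_contraction a" and b: "cond_contraction b"
begin

lemma weighted_cond_op_inner_L2:
  assumes f: "f \<in> L2 M"
  shows "(\<lambda>x. m x * cE M F (\<lambda>y. cnj (a y) * f y) x) \<in> L2 M"
    "(\<lambda>x. m x * cE M F (\<lambda>y. cnj (a y) * f y) x) \<in> borel_measurable F"
proof -
  note [measurable] = bounded_multiplier_meas[OF m]
  show "(\<lambda>x. m x * cE M F (\<lambda>y. cnj (a y) * f y) x) \<in> L2 M"
    using L2_bounded_multiplier[OF m] cE_contraction_L2(1)[OF cond_contraction_cnj[OF a] f] by blast
  show "(\<lambda>x. m x * cE M F (\<lambda>y. cnj (a y) * f y) x) \<in> borel_measurable F" by measurable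
qed

lemma weighted_cond_op_bounded: "bounded_op M (weighted_cond_op m a b)"
proof -
  obtain K where K: "K \<ge> 0" "\<And>g. g \<in> L2 M \<Longrightarrow> (\<lambda>x. m x * g x) \<in> L2 M"
    "\<And>g. g \<in> L2 M \<Longrightarrow> (LINT x|M. (cmod (m x * g x))\<^sup>2) \<le> K * (LINT x|M. (cmod (g x))\<^sup>2)"
    by (rule L2_bounded_multiplier[OF m]) blast
  note a' = cond_contraction_cnj[OF a]
  note [measurable] = cond_contraction_meas[OF a]
  show ?thesis
  proof (rule bounded_opI[where K = "K * 4"])
    fix f assume f: "f \<in> L2 M"
    show "weighted_cond_op m a b f \<in> L2 M"
      unfolding weighted_cond_op_def by (intro L2_contraction_mult b weighted_cond_op_inner_L2 f)
    let ?E = "cE M F (\<lambda>y. cnj (a y) * f y)"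
    have "(LINT x|M. (cmod (weighted_cond_op m a b f x))\<^sup>2) \<le> (LINT x|M. (cmod (m x * ?E x))\<^sup>2)"
      unfolding weighted_cond_op_def by (intro L2_contraction_mult b weighted_cond_op_inner_L2 f)
    also have "\<dots> \<le> K * (LINT x|M. (cmod (?E x))\<^sup>2)" by (intro K cE_contraction_L2 a' f)
    also have "\<dots> \<le> K * (4 * (LINT x|M. (cmod (f x))\<^sup>2))" by (intro mult_left_mono K cE_contraction_L2 a' f)
    finally show "(LINT x|M. (cmod (weighted_cond_op m a b f x))\<^sup>2) \<le> K * 4 * (LINT x|M. (cmod (f x))\<^sup>2)" by simp
  next
    fix f g assume f: "f \<in> L2 M" and g: "g \<in> L2 M"
    note [measurable] = L2_D(1)[OF f] L2_D(1)[OF g]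
    show "AE x in M. weighted_cond_op m a b f x = weighted_cond_op m a b g x" if "AE x in M. f x = g x"
    proof -
      have "AE x in M. cE M F (\<lambda>y. cnj (a y) * f y) x = cE M F (\<lambda>y. cnj (a y) * g y) x"
        by (rule cE_cong) (use that in auto)
      then show ?thesis unfolding weighted_cond_op_def by eventually_elim simp
    qed
    fix c
    have "AE x in M. cE M F (\<lambda>y. c * (cnj (a y) * f y) + cnj (a y) * g y) x
        = cE M F (\<lambda>y. c * (cnj (a y) * f y)) x + cE M F (\<lambda>y. cnj (a y) * g y) x"
      by (intro cE_add DE_mult cond_contraction_DE a' f g) measurable
    moreover have "AE x in M. cE M F (\<lambda>y. c * (cnj (a y) * f y)) x = c * cE M F (\<lambda>y. cnj (a y) * f y) x"
      by (intro cE_mult cond_contraction_DE a' f) measurable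
    moreover have "(\<lambda>y. cnj (a y) * (c * f y + g y)) = (\<lambda>y. c * (cnj (a y) * f y) + cnj (a y) * g y)"
      by (simp add: algebra_simps)
    ultimately show "AE x in M. weighted_cond_op m a b (\<lambda>y. c * f y + g y) x
        = c * weighted_cond_op m a b f x + weighted_cond_op m a b g x"
      unfolding weighted_cond_op_def by (auto simp: algebra_simps elim!: eventually_elim2)
  qed
qed

text \<open>The factor m E(cnj a f) is F-measurable, so E can be moved onto b cnj g. In the
  resulting integral the two sides play symmetric roles, and the adjoint can be read off.\<close>

lemma weighted_cond_op_inner:
  assumes f: "f \<in> L2 M" and g: "g \<in> L2 M"
  shows "l2_inner M (weighted_cond_op m a b f) g
    = (LINT x|M. m x * cE M F (\<lambda>y. cnj (a y) * f y) x * cnj (cE M F (\<lambda>y. cnj (b y) * g y) x))"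
proof -
  let ?h = "\<lambda>x. m x * cE M F (\<lambda>y. cnj (a y) * f y) x"
  have g': "(\<lambda>x. cnj (g x)) \<in> L2 M" using g by (simp add: L2_def borel_measurable_cnj)
  have int: "integrable M (\<lambda>x. b x * ?h x * cnj (g x))"
    by (intro L2_inner_integrable L2_contraction_mult b g weighted_cond_op_inner_L2 f)
  have "l2_inner M (weighted_cond_op m a b f) g = (LINT x|M. ?h x * (b x * cnj (g x)))"
    by (simp add: l2_inner_def weighted_cond_op_def mult_ac)
  also have "\<dots> = (LINT x|M. ?h x * cE M F (\<lambda>x. b x * cnj (g x)) x)"
  proof (rule cE_intg[symmetric])
    show "?h \<in> borel_measurable F" by (rule weighted_cond_op_inner_L2[OF f])
    show "(\<lambda>x. b x * cnj (g x)) \<in> DE M F" by (rule cond_contraction_DE[OF b g'])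
    show "integrable M (\<lambda>x. ?h x * (b x * cnj (g x)))" using int by (simp add: mult_ac)
  qed
  also have "\<dots> = (LINT x|M. ?h x * cnj (cE M F (\<lambda>y. cnj (b y) * g y) x))"
    by (simp flip: cE_cnj)
  finally show ?thesis by simp
qed

end

lemma weighted_cond_op_adjoint_eq:
  assumes "bounded_multiplier m" "cond_contraction a" "cond_contraction b" "f \<in> L2 M" "g \<in> L2 M"
  shows "l2_inner M (weighted_cond_op m a b f) g = l2_inner M f (weighted_cond_op (\<lambda>x. cnj (m x)) b a g)"
  by (subst (2) l2_inner_commute)
    (simp add: weighted_cond_op_inner assms bounded_multiplier_cnj mult_ac flip: Bochner_Integration.integral_cnj)

lemma weighted_cond_op_is_adjoint:
  assumes "bounded_multiplier m" "cond_contraction a" "cond_contraction b"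
  shows "is_adjoint M (weighted_cond_op m a b) (weighted_cond_op (\<lambda>x. cnj (m x)) b a)"
  using assms weighted_cond_op_bounded weighted_cond_op_adjoint_eq bounded_multiplier_cnj
  by (auto simp: is_adjoint_def)

text \<open>The inner operator yields d times an F-measurable function, which leaves the outer E;
  what stays behind is the scalar E(cnj a d).\<close>

lemma weighted_cond_op_compose:
  assumes m: "bounded_multiplier m" and a: "cond_contraction a" and b: "cond_contraction b"
    and n: "bounded_multiplier n" and c: "cond_contraction c" and d: "cond_contraction d"
    and f: "f \<in> L2 M"
  shows "AE x in M. weighted_cond_op m a b (weighted_cond_op n c d f) x
    = weighted_cond_op (\<lambda>x. m x * n x * cE M F (\<lambda>y. cnj (a y) * d y) x) c b f x"
proof -
  let ?h = "\<lambda>x. n x * cE M F (\<lambda>y. cnj (c y) * f y) x"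
  have "AE x in M. cE M F (\<lambda>x. ?h x * (cnj (a x) * d x)) x = ?h x * cE M F (\<lambda>x. cnj (a x) * d x) x"
    by (intro cE_mult weighted_cond_op_inner_L2[OF n c d] f cond_contraction_mult_bound cond_contraction_cnj a d)
  then show ?thesis
    unfolding weighted_cond_op_def by eventually_elim (simp add: mult_ac)
qed

lemma weighted_cond_op_cong:
  assumes "AE x in M. m x = n x"
  shows "AE x in M. weighted_cond_op m a b f x = weighted_cond_op n a b f x"
  using assms unfolding weighted_cond_op_def by eventually_elim simp

lemma nn_cond_exp_const: "AE x in M. nn_cond_exp M F (\<lambda>_. c) x = c"
  using nn_cond_exp_F_meas[of "\<lambda>_. c"] by (simp add: eq_commute)

text \<open>The negative part contributes E(0) = 0. Where the extended expectation is infinite, both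
  sides take the default value 0.\<close>

lemma real_cond_exp_nonneg:
  assumes [measurable]: "g \<in> borel_measurable M" and "\<And>x. 0 \<le> g x"
  shows "AE x in M. real_cond_exp M F g x = enn2real (nn_cond_exp M F (\<lambda>x. ennreal (g x)) x)"
proof -
  have "(\<lambda>x. ennreal (- g x)) = (\<lambda>_. 0)" using assms(2) by (auto simp: ennreal_neg)
  then show ?thesis using nn_cond_exp_const[of 0] by (auto simp: real_cond_exp_def)
qed

lemma cE_nonneg:
  assumes [measurable]: "g \<in> borel_measurable M" and "\<And>x. 0 \<le> g x"
  shows "AE x in M. cE M F (\<lambda>x. of_real (g x)) x = of_real (enn2real (nn_cond_exp M F (\<lambda>x. ennreal (g x)) x))"
proof -
  have "AE x in M. real_cond_exp M F (\<lambda>_. 0) x = 0"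
    using nn_cond_exp_const[of 0] by (auto simp: real_cond_exp_def)
  with real_cond_exp_nonneg[OF assms] show ?thesis
    by eventually_elim (simp add: cE_def)
qed

lemma cE_cnj_mult_self:
  assumes [measurable]: "d \<in> borel_measurable M"
  shows "AE x in M. cE M F (\<lambda>y. cnj (d y) * d y) x
    = of_real (enn2real (nn_cond_exp M F (\<lambda>y. ennreal ((cmod (d y))\<^sup>2)) x))"
proof -
  have "(\<lambda>y. cnj (d y) * d y) = (\<lambda>y. of_real ((cmod (d y))\<^sup>2))"
    by (simp only: complex_norm_square mult.commute)
  then show ?thesis using cE_nonneg[of "\<lambda>y. (cmod (d y))\<^sup>2"] by simp
qed

text \<open>The set where E(g) vanishes lies in F, so the integral of g over it equals that of E(g),
  namely 0.\<close>

lemma nn_cond_exp_eq_0: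
  assumes [measurable]: "g \<in> borel_measurable M"
  shows "AE x in M. nn_cond_exp M F g x = 0 \<longrightarrow> g x = 0"
proof -
  define Z where "Z = {x\<in>space F. nn_cond_exp M F g x = 0}"
  have ZF [measurable]: "Z \<in> sets F" unfolding Z_def by measurable
  have [measurable]: "Z \<in> sets M" by (rule sets_F[OF ZF])
  have "(\<integral>\<^sup>+x. indicator Z x * g x \<partial>M) = (\<integral>\<^sup>+x. indicator Z x * nn_cond_exp M F g x \<partial>M)"
    by (rule nn_cond_exp_intg[symmetric]) measurable
  also have "\<dots> = (\<integral>\<^sup>+x. 0 \<partial>M)" by (rule nn_integral_cong) (simp add: Z_def indicator_def)
  finally have "AE x in M. indicator Z x * g x = 0" by (subst nn_integral_0_iff_AE[symmetric]) auto
  with AE_space show ?thesis by eventually_elim (auto simp: Z_def space_F)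
qed

section \<open>Products, quadratic forms and order of these operators\<close>

lemma weighted_cond_op_comp:
  assumes "bounded_multiplier m" "cond_contraction a" "cond_contraction b"
    "bounded_multiplier n" "cond_contraction c" "cond_contraction d"
    and "AE x in M. m x * n x * cE M F (\<lambda>y. cnj (a y) * d y) x = p x"
  shows "op_eq M (weighted_cond_op m a b \<circ> weighted_cond_op n c d) (weighted_cond_op p c b)"
proof (rule op_eqI)
  fix f assume "f \<in> L2 M"
  from weighted_cond_op_compose[OF assms(1-6) this] weighted_cond_op_cong[OF assms(7), of c b f]
  show "AE x in M. (weighted_cond_op m a b \<circ> weighted_cond_op n c d) f x = weighted_cond_op p c b f x"
    by eventually_elim simp
qed

lemma weighted_cond_op_form:
  fixes m :: "'a \<Rightarrow> real"
  assumes m: "bounded_multiplier (\<lambda>x. of_real (m x))" and a: "cond_contraction a" and f: "f \<in> L2 M"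
  shows "integrable M (\<lambda>x. m x * (cmod (cE M F (\<lambda>y. cnj (a y) * f y) x))\<^sup>2)"
    and "l2_inner M (weighted_cond_op (\<lambda>x. of_real (m x)) a a f) f
      = of_real (LINT x|M. m x * (cmod (cE M F (\<lambda>y. cnj (a y) * f y) x))\<^sup>2)"
proof -
  let ?E = "cE M F (\<lambda>y. cnj (a y) * f y)"
  have eq: "of_real (m x) * ?E x * cnj (?E x) = complex_of_real (m x * (cmod (?E x))\<^sup>2)" for x
    by (simp only: of_real_mult complex_norm_square mult.assoc)
  have "integrable M (\<lambda>x. of_real (m x) * ?E x * cnj (?E x))"
    by (intro L2_inner_integrable weighted_cond_op_inner_L2[OF m a a] cE_contraction_L2 cond_contraction_cnj a f)
  then show "integrable M (\<lambda>x. m x * (cmod (?E x))\<^sup>2)"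
    unfolding eq by (simp only: complex_of_real_integrable_eq)
  show "l2_inner M (weighted_cond_op (\<lambda>x. of_real (m x)) a a f) f = of_real (LINT x|M. m x * (cmod (?E x))\<^sup>2)"
    unfolding weighted_cond_op_inner[OF m a a f f] eq by (rule integral_complex_of_real)
qed

lemma weighted_cond_op_mono:
  fixes m n :: "'a \<Rightarrow> real"
  assumes m: "bounded_multiplier (\<lambda>x. of_real (m x))" and n: "bounded_multiplier (\<lambda>x. of_real (n x))"
    and a: "cond_contraction a" and le: "AE x in M. m x \<le> n x"
  shows "op_le M (weighted_cond_op (\<lambda>x. of_real (m x)) a a) (weighted_cond_op (\<lambda>x. of_real (n x)) a a)"
  unfolding op_le_def
proof (intro ballI conjI)
  fix f assume f: "f \<in> L2 M"
  note forms = weighted_cond_op_form[OF m a f] weighted_cond_op_form[OF n a f]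
  show "Im (l2_inner M (weighted_cond_op (\<lambda>x. of_real (m x)) a a f) f)
      = Im (l2_inner M (weighted_cond_op (\<lambda>x. of_real (n x)) a a f) f)"
    by (simp add: forms)
  have "(LINT x|M. m x * (cmod (cE M F (\<lambda>y. cnj (a y) * f y) x))\<^sup>2)
      \<le> (LINT x|M. n x * (cmod (cE M F (\<lambda>y. cnj (a y) * f y) x))\<^sup>2)"
    by (rule integral_mono_AE[OF forms(1,3)]) (use le in \<open>eventually_elim, simp add: mult_right_mono\<close>)
  then show "Re (l2_inner M (weighted_cond_op (\<lambda>x. of_real (m x)) a a f) f)
      \<le> Re (l2_inner M (weighted_cond_op (\<lambda>x. of_real (n x)) a a f) f)"
    by (simp add: forms)
qed

lemma weighted_cond_op_positive:
  fixes m :: "'a \<Rightarrow> real"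
  assumes m: "bounded_multiplier (\<lambda>x. of_real (m x))" and "cond_contraction a" and "\<And>x. 0 \<le> m x"
  shows "positive_op M (weighted_cond_op (\<lambda>x. of_real (m x)) a a)"
  by (rule positive_opI) (use assms in \<open>simp_all add: weighted_cond_op_form\<close>)

text \<open>For A in F of finite measure the test vector a 1_A satisfies E(cnj a a 1_A) = 1_A 1_S,
  so the forms become the integrals of m and n over the intersection of A and S. Nothing is lost for
  m, which vanishes off S, and for n \<ge> 0 the domain may be enlarged to A.\<close>

lemma weighted_cond_op_le_imp_AE_le:
  fixes m n :: "'a \<Rightarrow> real"
  assumes m: "bounded_multiplier (\<lambda>x. of_real (m x))" and n: "bounded_multiplier (\<lambda>x. of_real (n x))"
    and m0: "\<And>x. 0 \<le> m x" and n0: "\<And>x. 0 \<le> n x"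
    and a: "a \<in> borel_measurable M"
    and S: "AE x in M. nn_cond_exp M F (\<lambda>x. ennreal ((cmod (a x))\<^sup>2)) x = indicator S x"
    and SF: "S \<in> sets F" and mS: "\<And>x. x \<in> space M \<Longrightarrow> x \<notin> S \<Longrightarrow> m x = 0"
    and le: "op_le M (weighted_cond_op (\<lambda>x. of_real (m x)) a a) (weighted_cond_op (\<lambda>x. of_real (n x)) a a)"
  shows "AE x in M. m x \<le> n x"
proof -
  have cc: "cond_contraction a"
    using S a unfolding cond_contraction_def by (auto simp: indicator_def elim: eventually_mono)
  note [measurable] = a sets_F[OF SF]
  have mF [measurable]: "m \<in> borel_measurable F" and nF [measurable]: "n \<in> borel_measurable F"
    using bounded_multiplier_meas[OF m] bounded_multiplier_meas[OF n] by (auto simp: borel_measurable_complex_iff)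
  note [measurable] = F_meas_imp_M_meas[OF mF] F_meas_imp_M_meas[OF nF]
  have "AE x in M. ennreal (m x) \<le> ennreal (n x)"
  proof (rule AE_le_if_set_nn_integral_le)
    fix A assume A [measurable]: "A \<in> sets F" and fin: "emeasure M A < \<infinity>"
    have [measurable]: "A \<in> sets M" by (rule sets_F[OF A])
    have iA: "(\<lambda>x. indicator A x) \<in> L2 M"
    proof -
      have "integrable M (indicator A :: 'a \<Rightarrow> real)" using fin by (simp add: integrable_real_indicator)
      moreover have "(\<lambda>x. (cmod (indicator A x))\<^sup>2) = (indicator A :: 'a \<Rightarrow> real)" by (auto simp: indicator_def)
      ultimately show ?thesis by (simp add: L2_def)
    qed
    have f: "(\<lambda>x. a x * indicator A x) \<in> L2 M" (is "?f \<in> _")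
      by (intro L2_contraction_mult cc iA) measurable
    let ?E = "cE M F (\<lambda>y. cnj (a y) * ?f y)"
    have E: "AE x in M. (cmod (?E x))\<^sup>2 = indicator A x * indicator S x"
    proof -
      have eq: "(\<lambda>y. cnj (a y) * ?f y) = (\<lambda>y. of_real (indicator A y) * (cnj (a y) * a y))"
        by (auto simp: fun_eq_iff indicator_def)
      have "AE x in M. cE M F (\<lambda>y. of_real (indicator A y) * (cnj (a y) * a y)) x
          = of_real (indicator A x) * cE M F (\<lambda>y. cnj (a y) * a y) x"
        by (rule cE_mult_real) measurable
      with cE_cnj_mult_self[OF a] S show ?thesis
        unfolding eq by eventually_elim (auto simp: indicator_def)
    qed
    have form: "integrable M (\<lambda>x. p x * indicator A x * indicator S x) \<and>
        Re (l2_inner M (weighted_cond_op (\<lambda>x. of_real (p x)) a a ?f) ?f) = (LINT x|M. p x * indicator A x * indicator S x)"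
      if p: "bounded_multiplier (\<lambda>x. of_real (p x))" and [measurable]: "p \<in> borel_measurable M" for p :: "'a \<Rightarrow> real"
    proof -
      have ae: "AE x in M. p x * (cmod (?E x))\<^sup>2 = p x * indicator A x * indicator S x"
        using E by eventually_elim simp
      have "integrable M (\<lambda>x. p x * indicator A x * indicator S x)"
        by (rule integrable_cong_AE_imp[OF weighted_cond_op_form(1)[OF p cc f] _ ae]) measurable
      moreover have "(LINT x|M. p x * (cmod (?E x))\<^sup>2) = (LINT x|M. p x * indicator A x * indicator S x)"
        by (rule integral_cong_AE) (use ae in auto)
      ultimately show ?thesis by (simp add: weighted_cond_op_form(2)[OF p cc f])
    qed
    note fm = form[OF m F_meas_imp_M_meas[OF mF]] and fn = form[OF n F_meas_imp_M_meas[OF nF]]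
    show "(\<integral>\<^sup>+x\<in>A. ennreal (m x) \<partial>M) \<le> (\<integral>\<^sup>+x\<in>A. ennreal (n x) \<partial>M)"
    proof -
      have "(\<integral>\<^sup>+x\<in>A. ennreal (m x) \<partial>M) = (\<integral>\<^sup>+x. ennreal (m x * indicator A x * indicator S x) \<partial>M)"
        by (rule nn_integral_cong) (use mS in \<open>auto simp: indicator_def\<close>)
      also have "\<dots> = ennreal (LINT x|M. m x * indicator A x * indicator S x)"
        by (rule nn_integral_eq_integral) (use fm m0 in auto)
      also have "\<dots> \<le> ennreal (LINT x|M. n x * indicator A x * indicator S x)"
        using le[unfolded op_le_def, THEN bspec, OF f] fm fn by (intro ennreal_leI) simp
      also have "\<dots> = (\<integral>\<^sup>+x. ennreal (n x * indicator A x * indicator S x) \<partial>M)"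
        by (rule nn_integral_eq_integral[symmetric]) (use fn n0 in auto)
      also have "\<dots> \<le> (\<integral>\<^sup>+x\<in>A. ennreal (n x) \<partial>M)"
        by (rule nn_integral_mono) (auto simp: indicator_def)
      finally show ?thesis .
    qed
  qed auto
  then show ?thesis by (simp add: n0)
qed

text \<open>Every operator involved has the form b m E(cnj a f), so both sides of the operator
  inequality collapse to such operators with a on both sides, and the order becomes a comparison of
  multipliers.\<close>

theorem quasi_star_A_weighted_cond_op_iff:
  fixes k :: "'a \<Rightarrow> real" and a b :: "'a \<Rightarrow> complex" and T :: "'a op"
  defines "c \<equiv> cE M F (\<lambda>y. cnj (a y) * b y)"
  assumes a: "a \<in> borel_measurable M" and b: "b \<in> borel_measurable M"
    and Sa: "AE x in M. nn_cond_exp M F (\<lambda>x. ennreal ((cmod (a x))\<^sup>2)) x = indicator S x"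
    and Sb: "AE x in M. nn_cond_exp M F (\<lambda>x. ennreal ((cmod (b x))\<^sup>2)) x = indicator S x"
    and S: "S \<in> sets F" and kS: "\<And>x. x \<in> space M \<Longrightarrow> x \<notin> S \<Longrightarrow> k x = 0"
    and k: "bounded_multiplier (\<lambda>x. of_real (k x))" and k0: "\<And>x. 0 \<le> k x"
    and T: "bounded_op M T" and TW: "op_eq M T (weighted_cond_op (\<lambda>x. of_real (k x)) a b)"
  shows "quasi_star_A M T \<longleftrightarrow> (AE x in M. (k x)^4 \<le> (k x)^4 * (cmod (c x))^3)"
proof -
  have cca: "cond_contraction a" and ccb: "cond_contraction b"
    using Sa Sb a b unfolding cond_contraction_def by (auto simp: indicator_def elim: eventually_mono)
  have c: "bounded_multiplier c"
    unfolding c_def bounded_multiplier_def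
    using cond_contraction_mult_bound(2)[OF cond_contraction_cnj[OF cca] ccb] by auto
  let ?k = "\<lambda>x. complex_of_real (k x)" and ?c = "\<lambda>x. complex_of_real (cmod (c x))"
  let ?W = weighted_cond_op
  note bm = k c bounded_multiplier_cnj bounded_multiplier_mult bounded_multiplier_cmod
  have Eab: "cE M F (\<lambda>y. cnj (a y) * b y) x = c x" for x by (simp add: c_def)
  have Eba: "cE M F (\<lambda>y. cnj (b y) * a y) x = cnj (c x)" for x
    unfolding c_def cE_cnj[symmetric] by (simp add: mult.commute)
  \<comment> \<open>E(|a|^2) and E(|b|^2) are 1 only on S; the accompanying factor k, which vanishes
    off S, absorbs the difference. Hence these expectations are always simplified together with one
    k.\<close>
  have kE: "AE x in M. ?k x * cE M F (\<lambda>y. cnj (d y) * d y) x = ?k x"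
    if d: "d \<in> borel_measurable M"
      "AE x in M. nn_cond_exp M F (\<lambda>x. ennreal ((cmod (d x))\<^sup>2)) x = indicator S x" for d
    using cE_cnj_mult_self[OF d(1)] d(2) AE_space by eventually_elim (auto simp: indicator_def kS)
  note Eaa = kE[OF a Sa] and Ebb = kE[OF b Sb]
  \<comment> \<open>T^2 has multiplier k^2 c, so (adjoint T^2) T^2 has multiplier k^4 |c|^2 with a
    on both sides; m is its nonnegative root.\<close>
  define m where "m = (\<lambda>x. k x * k x * cmod (c x))"
  let ?m = "\<lambda>x. complex_of_real (m x)" and ?kkc = "\<lambda>x. ?k x * ?k x * c x"
  let ?W1 = "?W ?k a b" and ?Ws = "?W ?k b a" and ?P = "?W ?m a a" and ?Q = "?W ?k b b"
    and ?W2 = "?W ?kkc a b" and ?W2s = "?W (\<lambda>x. cnj (?kkc x)) b a"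
    and ?L = "?W (\<lambda>x. of_real ((k x)^4)) a a" and ?R = "?W (\<lambda>x. of_real ((k x)^4 * (cmod (c x))^3)) a a"
  have m: "bounded_multiplier ?m"
    using bm(4)[OF bm(4)[OF k k] bm(5)[OF c]] by (simp add: m_def)
  have kkc: "bounded_multiplier ?kkc" by (intro bm)
  have L: "bounded_multiplier (\<lambda>x. of_real ((k x)^4))"
    using bm(4)[OF bm(4)[OF k k] bm(4)[OF k k]] by (simp add: power4_eq_xxxx mult.assoc)
  have R: "bounded_multiplier (\<lambda>x. of_real ((k x)^4 * (cmod (c x))^3))"
    using bm(4)[OF L bm(4)[OF bm(5)[OF c] bm(4)[OF bm(5)[OF c] bm(5)[OF c]]]]
    by (simp add: power3_eq_cube mult.assoc)
  have W1: "bounded_op M ?W1" and Ws: "bounded_op M ?Ws" and P: "bounded_op M ?P" and Q: "bounded_op M ?Q"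
    and W2: "bounded_op M ?W2" and W2s: "bounded_op M ?W2s" and opL: "bounded_op M ?L" and opR: "bounded_op M ?R"
    by (intro weighted_cond_op_bounded k m kkc L R bounded_multiplier_cnj cca ccb)+
  have adj1: "is_adjoint M ?W1 ?Ws" and adj1': "is_adjoint M ?Ws ?W1" and adj2: "is_adjoint M ?W2 ?W2s"
    using weighted_cond_op_is_adjoint[OF k cca ccb] weighted_cond_op_is_adjoint[OF k ccb cca]
      weighted_cond_op_is_adjoint[OF kkc cca ccb] by simp_all
  have TT: "op_eq M (T \<circ> T) ?W2"
  proof -
    have "op_eq M (T \<circ> T) (?W1 \<circ> ?W1)" by (rule op_eq_comp[OF TW TW T T W1])
    also have "op_eq M (?W1 \<circ> ?W1) ?W2"
      by (rule weighted_cond_op_comp[OF k cca ccb k cca ccb]) (simp add: Eab)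
    finally show ?thesis .
  qed
  have bTT: "bounded_op M (T \<circ> T)" by (rule bounded_op_comp[OF T T])
  have W2P: "op_eq M (?W2s \<circ> ?W2) (?P \<circ> ?P)"
  proof -
    have "op_eq M (?W2s \<circ> ?W2) (?W (\<lambda>x. ?m x * ?m x) a a)"
    proof (rule weighted_cond_op_comp[OF bounded_multiplier_cnj[OF kkc] ccb cca kkc cca ccb])
      show "AE x in M. cnj (?kkc x) * ?kkc x * cE M F (\<lambda>y. cnj (b y) * b y) x = ?m x * ?m x"
        using Ebb
      proof eventually_elim
        case (elim x)
        have "cnj (?kkc x) * ?kkc x * cE M F (\<lambda>y. cnj (b y) * b y) x
            = ?k x * ?k x * ?k x * (c x * cnj (c x)) * (?k x * cE M F (\<lambda>y. cnj (b y) * b y) x)"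
          by (simp add: algebra_simps)
        also have "\<dots> = ?m x * ?m x"
          unfolding elim complex_norm_square[symmetric] by (simp add: m_def power2_eq_square algebra_simps)
        finally show ?case .
      qed
    qed
    also have "op_eq M \<dots> (?P \<circ> ?P)"
    proof (rule op_eq_sym, rule weighted_cond_op_comp[OF m cca cca m cca cca])
      show "AE x in M. ?m x * ?m x * cE M F (\<lambda>y. cnj (a y) * a y) x = ?m x * ?m x"
        using Eaa
      proof eventually_elim
        case (elim x)
        have "?m x * ?m x * cE M F (\<lambda>y. cnj (a y) * a y) x
            = ?m x * ?k x * ?c x * (?k x * cE M F (\<lambda>y. cnj (a y) * a y) x)"
          by (simp add: m_def algebra_simps)
        then show ?case unfolding elim by (simp add: m_def algebra_simps)
      qed
    qed
    finally show ?thesis .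
  qed
  have posP: "positive_op M ?P"
    by (rule weighted_cond_op_positive[OF m cca]) (simp add: m_def k0)
  \<comment> \<open>The given root and \<open>?P\<close> are positive roots of operators that agree
    almost everywhere, hence they agree themselves.\<close>
  have abs1: "bounded_op M R1 \<and> op_eq M R1 ?P" if "is_abs M (T \<circ> T) R1" for R1
  proof -
    obtain Ss where Ss: "is_adjoint M (T \<circ> T) Ss" and sq: "is_pos_sqrt M (Ss \<circ> (T \<circ> T)) R1"
      using \<open>is_abs M (T \<circ> T) R1\<close> by (auto simp: is_abs_def)
    have bSs: "bounded_op M Ss" using Ss by (simp add: is_adjoint_def)
    have R1: "bounded_op M R1" "positive_op M R1" using sq by (auto simp: is_pos_sqrt_def)
    have "op_eq M (R1 \<circ> R1) (Ss \<circ> (T \<circ> T))" using sq by (simp add: is_pos_sqrt_def op_eq_def)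
    also have "op_eq M \<dots> (?W2s \<circ> ?W2)"
      by (rule op_eq_comp[OF adjoint_unique[OF Ss adj2 TT bTT W2] TT bSs bTT W2])
    also note W2P
    finally have "op_eq M (R1 \<circ> R1) (?P \<circ> ?P)" .
    then have "op_eq M R1 ?P"
      by (intro op_eqI positive_sqrt_unique[OF R1 P posP]) (simp_all add: op_eq_def)
    with R1 show ?thesis by simp
  qed
  \<comment> \<open>R2 occurs only squared, and its square is U after Ts with U an adjoint of Ts;
    thus R2 never has to be identified. Only R1, which occurs once, relies on uniqueness of square
    roots.\<close>
  have reduce: "op_le M (Ts \<circ> R2 \<circ> R2 \<circ> T) (Ts \<circ> R1 \<circ> T) \<longleftrightarrow> op_le M ?L ?R"
    if Ts: "is_adjoint M T Ts" and R1: "is_abs M (T \<circ> T) R1" and R2: "is_abs M Ts R2" for Ts R1 R2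
  proof -
    have bTs: "bounded_op M Ts" using Ts by (simp add: is_adjoint_def)
    have TsW: "op_eq M Ts ?Ws" by (rule adjoint_unique[OF Ts adj1 TW T W1])
    obtain U where U: "is_adjoint M Ts U" and sq: "is_pos_sqrt M (U \<circ> Ts) R2"
      using R2 by (auto simp: is_abs_def)
    have bU: "bounded_op M U" using U by (simp add: is_adjoint_def)
    have UW: "op_eq M U ?W1" by (rule adjoint_unique[OF U adj1' TsW bTs Ws])
    have bR2: "bounded_op M R2" using sq by (simp add: is_pos_sqrt_def)
    have R1': "bounded_op M R1" "op_eq M R1 ?P" using abs1[OF R1] by auto
    note bc = bounded_op_comp bTs bU bR2 R1'(1) T W1 Ws P
    have "op_eq M (R2 \<circ> R2) (U \<circ> Ts)" using sq by (simp add: is_pos_sqrt_def op_eq_def)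
    also have "op_eq M \<dots> (?W1 \<circ> ?Ws)" by (intro op_eq_comp UW TsW bc)
    finally have R2R2: "op_eq M (R2 \<circ> R2) (?W1 \<circ> ?Ws)" .
    have "op_eq M (Ts \<circ> ((R2 \<circ> R2) \<circ> T)) (?Ws \<circ> ((?W1 \<circ> ?Ws) \<circ> ?W1))"
      by (intro op_eq_comp[OF TsW] op_eq_comp[OF R2R2] TW bc)
    also have "op_eq M \<dots> (?Ws \<circ> (?W1 \<circ> ?W (\<lambda>x. ?k x * ?k x) a a))"
    proof -
      have "op_eq M (?Ws \<circ> ?W1) (?W (\<lambda>x. ?k x * ?k x) a a)"
        by (rule weighted_cond_op_comp[OF k ccb cca k cca ccb])
          (use Ebb in \<open>eventually_elim, simp add: mult.assoc\<close>)
      then have "op_eq M (?Ws \<circ> (?W1 \<circ> (?Ws \<circ> ?W1))) (?Ws \<circ> (?W1 \<circ> ?W (\<lambda>x. ?k x * ?k x) a a))"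
        by (intro op_eq_comp bc weighted_cond_op_bounded bm cca) (auto simp: op_eq_def)
      then show ?thesis by (simp add: comp_assoc)
    qed
    also have "op_eq M \<dots> (?Ws \<circ> ?W (\<lambda>x. ?k x * ?k x * ?k x) a b)"
    proof -
      have "op_eq M (?W1 \<circ> ?W (\<lambda>x. ?k x * ?k x) a a) (?W (\<lambda>x. ?k x * ?k x * ?k x) a b)"
        by (rule weighted_cond_op_comp[OF k cca ccb bm(4)[OF k k] cca cca])
          (use Eaa in \<open>eventually_elim, simp add: mult.assoc\<close>)
      then show ?thesis
        by (intro op_eq_comp bc weighted_cond_op_bounded bm cca ccb) (auto simp: op_eq_def)
    qed
    also have "op_eq M \<dots> ?L"
      by (rule weighted_cond_op_comp[OF k ccb cca bm(4)[OF bm(4)[OF k k] k] cca ccb])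
        (use Ebb in \<open>eventually_elim, simp add: mult.assoc power4_eq_xxxx\<close>)
    finally have l: "op_eq M (Ts \<circ> R2 \<circ> R2 \<circ> T) ?L" by (simp add: comp_assoc)
    have "op_eq M (Ts \<circ> (R1 \<circ> T)) (?Ws \<circ> (?P \<circ> ?W1))"
      by (intro op_eq_comp TsW R1' TW bc)
    also have "op_eq M \<dots> (?Ws \<circ> ?W (\<lambda>x. ?m x * ?k x * c x) a a)"
    proof -
      have "op_eq M (?P \<circ> ?W1) (?W (\<lambda>x. ?m x * ?k x * c x) a a)"
        by (rule weighted_cond_op_comp[OF m cca cca k cca ccb]) (simp add: Eab)
      then show ?thesis
        by (intro op_eq_comp bc weighted_cond_op_bounded bm m cca ccb) (auto simp: op_eq_def)
    qed
    also have "op_eq M \<dots> ?R"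
    proof (rule weighted_cond_op_comp[OF k ccb cca bm(4)[OF bm(4)[OF m k] c] cca cca], rule AE_I2)
      fix x
      have "?k x * (?m x * ?k x * c x) * cE M F (\<lambda>y. cnj (b y) * a y) x
          = ?k x * ?m x * ?k x * (c x * cnj (c x))" by (simp add: Eba)
      also have "\<dots> = of_real ((k x)^4 * (cmod (c x))^3)"
        unfolding complex_norm_square[symmetric]
        by (simp add: m_def power4_eq_xxxx power3_eq_cube power2_eq_square algebra_simps)
      finally show "?k x * (?m x * ?k x * c x) * cE M F (\<lambda>y. cnj (b y) * a y) x = of_real ((k x)^4 * (cmod (c x))^3)" .
    qed
    finally have r: "op_eq M (Ts \<circ> R1 \<circ> T) ?R" by (simp add: comp_assoc)
    show ?thesis by (rule op_le_cong[OF l r _ _ opL opR]) (intro bc)+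
  qed
  \<comment> \<open>Concrete witnesses for the three quantified operators: without them, membership
    in the class could not be applied to obtain the order relation.\<close>
  have exT: "is_adjoint M T ?Ws" by (rule is_adjoint_op_eq[OF adj1 op_eq_sym[OF TW] W1 T])
  have exTT: "is_abs M (T \<circ> T) ?P"
  proof -
    have "is_adjoint M (T \<circ> T) ?W2s" by (rule is_adjoint_op_eq[OF adj2 op_eq_sym[OF TT] W2 bTT])
    moreover have "op_eq M (?P \<circ> ?P) (?W2s \<circ> (T \<circ> T))"
    proof (rule op_eq_trans[OF op_eq_sym[OF W2P]])
      show "op_eq M (?W2s \<circ> ?W2) (?W2s \<circ> (T \<circ> T))"
        by (rule op_eq_comp[OF _ op_eq_sym[OF TT] W2s W2 bTT]) (simp add: op_eq_def)
    qed
    ultimately show ?thesis using P posP by (auto simp: is_abs_def is_pos_sqrt_def op_eq_def)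
  qed
  have exTs: "is_abs M ?Ws ?Q"
  proof -
    have "op_eq M (?Q \<circ> ?Q) (?W (\<lambda>x. ?k x * ?k x) b b)"
      by (rule weighted_cond_op_comp[OF k ccb ccb k ccb ccb])
        (use Ebb in \<open>eventually_elim, simp add: mult.assoc\<close>)
    also have "op_eq M \<dots> (?W1 \<circ> ?Ws)"
      by (rule op_eq_sym, rule weighted_cond_op_comp[OF k cca ccb k ccb cca])
        (use Eaa in \<open>eventually_elim, simp add: mult.assoc\<close>)
    finally show ?thesis
      using Q adj1' weighted_cond_op_positive[OF k ccb k0] by (auto simp: is_abs_def is_pos_sqrt_def op_eq_def)
  qed
  have "quasi_star_A M T \<longleftrightarrow> op_le M ?L ?R"
    unfolding quasi_star_A_def using T reduce reduce[OF exT exTT exTs] exT exTT exTs by blast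
  also have "\<dots> \<longleftrightarrow> (AE x in M. (k x)^4 \<le> (k x)^4 * (cmod (c x))^3)"
  proof
    assume "op_le M ?L ?R"
    then show "AE x in M. (k x)^4 \<le> (k x)^4 * (cmod (c x))^3"
      by (rule weighted_cond_op_le_imp_AE_le[OF L R _ _ a Sa S, rotated 3]) (auto simp: k0 kS)
  next
    assume "AE x in M. (k x)^4 \<le> (k x)^4 * (cmod (c x))^3"
    then show "op_le M ?L ?R" by (rule weighted_cond_op_mono[OF L R cca])
  qed
  finally show ?thesis .
qed

text \<open>The bound comes from testing \<open>T\<close> on \<open>cnj u\<close> truncated to \<open>{|u| \<le> n} \<inter> A\<close> with \<open>A\<close> of finite measure.\<close>

lemma wcte_bound:
  assumes u [measurable]: "u \<in> borel_measurable M" and w [measurable]: "w \<in> borel_measurable M"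
    and T: "bounded_op M (wcte M F w u)"
  obtains B :: real where "AE x in M. nn_cond_exp M F (\<lambda>x. ennreal ((cmod (w x))\<^sup>2)) x
     * nn_cond_exp M F (\<lambda>x. ennreal ((cmod (u x))\<^sup>2)) x \<le> ennreal B"
proof -
  obtain B where B0: "B \<ge> 0" and B: "\<And>f. f \<in> L2 M \<Longrightarrow>
      (LINT x|M. (cmod (wcte M F w u f x))\<^sup>2) \<le> B * (LINT x|M. (cmod (f x))\<^sup>2)"
    by (rule bounded_opE[OF T]) blast
  let ?N = "nn_cond_exp M F"
  let ?K = "?N (\<lambda>x. ennreal ((cmod (w x))\<^sup>2))"
  \<comment> \<open>Truncation makes E(v_n^2) at most n^2, so it is finite and can be cancelled;
    finiteness of E(|u|^2) is not known here.\<close>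
  define v where "v n x = (if cmod (u x) \<le> real n then cmod (u x) else 0)" for n x
  have v [measurable]: "v n \<in> borel_measurable M" for n unfolding v_def by measurable
  have v0: "0 \<le> v n x" and vn: "v n x \<le> real n" and vu: "v n x \<le> cmod (u x)" for n x
    by (simp_all add: v_def)
  let ?J = "\<lambda>n. ?N (\<lambda>x. ennreal ((v n x)\<^sup>2))"
  have Jfin: "AE x in M. ?J n x \<le> ennreal ((real n)\<^sup>2)" for n
  proof -
    have "AE x in M. ?J n x \<le> ?N (\<lambda>_. ennreal ((real n)\<^sup>2)) x"
      by (intro nn_cond_exp_mono AE_I2 ennreal_leI power_mono v0 vn) measurable
    with nn_cond_exp_const[of "ennreal ((real n)\<^sup>2)"] show ?thesis by eventually_elim simp
  qed
  have KJ: "AE x in M. ?K x * ?J n x \<le> ennreal B" for n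
  proof -
    \<comment> \<open>Integrated over A, the left side is |T f|^2 and the right side is B |f|^2 for
      the truncated test function f.\<close>
    have "AE x in M. ?K x * (?J n x)\<^sup>2 \<le> ennreal B * ?J n x"
    proof (rule AE_le_if_set_nn_integral_le)
      show "AE x in M. ennreal B * ?J n x < \<infinity>"
        using Jfin[of n] by eventually_elim (auto simp: ennreal_mult_less_top intro: le_less_trans)
      fix A assume AF [measurable]: "A \<in> sets F" and fin: "emeasure M A < \<infinity>"
      have A [measurable]: "A \<in> sets M" by (rule sets_F[OF AF])
      \<comment> \<open>With this f one has u f = v_n^2 1_A, hence E(u f) = 1_A E(v_n^2).\<close>
      define f where "f x = cnj (u x) * of_real (indicator {x. cmod (u x) \<le> real n} x * indicator A x)" for x
      have fm [measurable]: "f \<in> borel_measurable M" unfolding f_def by measurable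
      have f2: "(cmod (f x))\<^sup>2 = (v n x)\<^sup>2 * indicator A x" for x
        by (auto simp: f_def v_def indicator_def)
      have iA: "integrable M (indicator A :: 'a \<Rightarrow> real)" using fin by (simp add: integrable_real_indicator)
      have intf: "integrable M (\<lambda>x. (cmod (f x))\<^sup>2)"
        unfolding f2
      proof (rule Bochner_Integration.integrable_bound)
        show "integrable M (\<lambda>x. (real n)\<^sup>2 * indicator A x :: real)" using iA by simp
        show "AE x in M. norm ((v n x)\<^sup>2 * indicator A x) \<le> norm ((real n)\<^sup>2 * indicator A x :: real)"
          using v0 vn by (intro AE_I2) (auto simp: indicator_def intro!: power_mono)
      qed measurable
      have f: "f \<in> L2 M" using intf by (simp add: L2_def)
      let ?Tf = "wcte M F w u f"
      note Tf = bounded_op_L2[OF T f]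
      have "AE x in M. (cmod (?Tf x))\<^sup>2 = (cmod (w x))\<^sup>2 * (indicator A x * (enn2real (?J n x))\<^sup>2)"
      proof -
        have "(\<lambda>y. u y * f y) = (\<lambda>y. of_real (indicator A y) * of_real ((v n y)\<^sup>2))"
          by (auto simp: fun_eq_iff f_def v_def indicator_def complex_norm_square simp del: of_real_power)
        moreover have "AE x in M. cE M F (\<lambda>y. of_real (indicator A y) * of_real ((v n y)\<^sup>2)) x
            = of_real (indicator A x) * cE M F (\<lambda>y. of_real ((v n y)\<^sup>2)) x"
          by (rule cE_mult_real) measurable
        moreover have "AE x in M. cE M F (\<lambda>y. of_real ((v n y)\<^sup>2)) x = of_real (enn2real (?J n x))"
          by (rule cE_nonneg) auto
        ultimately show ?thesis
          unfolding wcte_def by (auto simp: norm_mult power_mult_distrib indicator_def elim!: eventually_elim2)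
      qed
      then have Tf2: "AE x in M. ennreal ((cmod (?Tf x))\<^sup>2) = (indicator A x * (?J n x)\<^sup>2) * ennreal ((cmod (w x))\<^sup>2)"
        using Jfin[of n]
      proof eventually_elim
        case (elim x)
        obtain r where "?J n x = ennreal r" "0 \<le> r" using elim(2) by (cases "?J n x") (auto simp: top_unique)
        then show ?case
          using elim(1) by (simp add: indicator_def ennreal_mult ennreal_power mult.commute)
      qed
      have "(\<integral>\<^sup>+x\<in>A. (?K x * (?J n x)\<^sup>2) \<partial>M) = (\<integral>\<^sup>+x. (indicator A x * (?J n x)\<^sup>2) * ?K x \<partial>M)"
        by (rule nn_integral_cong) (simp add: mult_ac)
      also have "\<dots> = (\<integral>\<^sup>+x. (indicator A x * (?J n x)\<^sup>2) * ennreal ((cmod (w x))\<^sup>2) \<partial>M)"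
        by (rule nn_cond_exp_intg) measurable
      also have "\<dots> = (\<integral>\<^sup>+x. ennreal ((cmod (?Tf x))\<^sup>2) \<partial>M)"
        by (rule nn_integral_cong_AE) (use Tf2 in \<open>auto simp: eq_commute\<close>)
      also have "\<dots> = ennreal (LINT x|M. (cmod (?Tf x))\<^sup>2)"
        using L2_D(2)[OF Tf] by (simp add: nn_integral_eq_integral)
      also have "\<dots> \<le> ennreal (B * (LINT x|M. (cmod (f x))\<^sup>2))" by (rule ennreal_leI[OF B[OF f]])
      also have "\<dots> = ennreal B * (\<integral>\<^sup>+x. ennreal ((cmod (f x))\<^sup>2) \<partial>M)"
        using B0 intf by (simp add: ennreal_mult nn_integral_eq_integral)
      also have "(\<integral>\<^sup>+x. ennreal ((cmod (f x))\<^sup>2) \<partial>M) = (\<integral>\<^sup>+x. indicator A x * ennreal ((v n x)\<^sup>2) \<partial>M)"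
        by (rule nn_integral_cong) (simp add: f2 indicator_def)
      also have "\<dots> = (\<integral>\<^sup>+x. indicator A x * ?J n x \<partial>M)"
        by (rule nn_cond_exp_intg[symmetric]) measurable
      also have "ennreal B * \<dots> = (\<integral>\<^sup>+x\<in>A. (ennreal B * ?J n x) \<partial>M)"
        by (subst nn_integral_cmult[symmetric]) (auto simp: mult_ac intro!: nn_integral_cong)
      finally show "(\<integral>\<^sup>+x\<in>A. (?K x * (?J n x)\<^sup>2) \<partial>M) \<le> (\<integral>\<^sup>+x\<in>A. (ennreal B * ?J n x) \<partial>M)" .
    qed measurable
    then show ?thesis
      using Jfin[of n]
    proof eventually_elim
      case (elim x)
      \<comment> \<open>One factor E(v_n^2) = r is cancelled. If r = 0 the claim holds directly,
        since a product with 0 is 0 even where E(|w|^2) is infinite.\<close>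
      obtain r where r: "?J n x = ennreal r" "0 \<le> r" using elim(2) by (cases "?J n x") (auto simp: top_unique)
      show ?case
      proof (cases "r = 0")
        case False
        with r have "0 < r" by simp
        have "?J n x * (?K x * ?J n x) \<le> ?J n x * ennreal B"
          using elim(1) by (simp add: power2_eq_square mult_ac)
        then show ?thesis
          using r \<open>0 < r\<close> by (subst (asm) ennreal_mult_le_mult_iff) auto
      qed (use r in simp)
    qed
  qed
  \<comment> \<open>The limit in n is taken inside integrals over A, where E(v_n^2) can be exchanged
    for v_n^2 and monotone convergence applies.\<close>
  have "AE x in M. ?K x * ?N (\<lambda>x. ennreal ((cmod (u x))\<^sup>2)) x \<le> ennreal B"
  proof (rule AE_le_if_set_nn_integral_le)
    fix A assume AF [measurable]: "A \<in> sets F" and fin: "emeasure M A < \<infinity>"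
    have A [measurable]: "A \<in> sets M" by (rule sets_F[OF AF])
    have sup: "(SUP n. (indicator A x * ?K x) * ennreal ((v n x)\<^sup>2)) = (indicator A x * ?K x) * ennreal ((cmod (u x))\<^sup>2)" for x
    proof -
      obtain n where n: "cmod (u x) \<le> real n" using real_arch_simple by blast
      have "(SUP n. ennreal ((v n x)\<^sup>2)) = ennreal ((cmod (u x))\<^sup>2)"
      proof (rule antisym)
        show "(SUP n. ennreal ((v n x)\<^sup>2)) \<le> ennreal ((cmod (u x))\<^sup>2)"
          by (intro SUP_least ennreal_leI power_mono vu v0)
        have "ennreal ((cmod (u x))\<^sup>2) = ennreal ((v n x)\<^sup>2)" using n by (simp add: v_def)
        then show "ennreal ((cmod (u x))\<^sup>2) \<le> (SUP n. ennreal ((v n x)\<^sup>2))" by (metis SUP_upper UNIV_I)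
      qed
      then show ?thesis by (simp add: SUP_mult_left_ennreal[symmetric])
    qed
    have "(\<integral>\<^sup>+x\<in>A. (?K x * ?N (\<lambda>x. ennreal ((cmod (u x))\<^sup>2)) x) \<partial>M)
        = (\<integral>\<^sup>+x. (indicator A x * ?K x) * ?N (\<lambda>x. ennreal ((cmod (u x))\<^sup>2)) x \<partial>M)"
      by (rule nn_integral_cong) (simp add: mult_ac)
    also have "\<dots> = (\<integral>\<^sup>+x. (indicator A x * ?K x) * ennreal ((cmod (u x))\<^sup>2) \<partial>M)"
      by (rule nn_cond_exp_intg) measurable
    also have "\<dots> = (\<integral>\<^sup>+x. (SUP n. (indicator A x * ?K x) * ennreal ((v n x)\<^sup>2)) \<partial>M)"
      by (simp only: sup)
    also have "\<dots> = (SUP n. \<integral>\<^sup>+x. (indicator A x * ?K x) * ennreal ((v n x)\<^sup>2) \<partial>M)"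
    proof (rule nn_integral_monotone_convergence_SUP)
      show "incseq (\<lambda>n x. (indicator A x * ?K x) * ennreal ((v n x)\<^sup>2))"
        by (intro incseq_SucI le_funI mult_left_mono ennreal_leI power_mono v0) (simp_all add: v_def)
    qed measurable
    also have "\<dots> \<le> (\<integral>\<^sup>+x\<in>A. ennreal B \<partial>M)"
    proof (rule SUP_least)
      fix n
      have "(\<integral>\<^sup>+x. (indicator A x * ?K x) * ennreal ((v n x)\<^sup>2) \<partial>M) = (\<integral>\<^sup>+x. (indicator A x * ?K x) * ?J n x \<partial>M)"
        by (rule nn_cond_exp_intg[symmetric]) measurable
      also have "\<dots> \<le> (\<integral>\<^sup>+x\<in>A. ennreal B \<partial>M)"
        by (rule nn_integral_mono_AE) (use KJ[of n] in \<open>eventually_elim, simp add: indicator_def\<close>)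
      finally show "(\<integral>\<^sup>+x. (indicator A x * ?K x) * ennreal ((v n x)\<^sup>2) \<partial>M) \<le> (\<integral>\<^sup>+x\<in>A. ennreal B \<partial>M)" .
    qed
    finally show "(\<integral>\<^sup>+x\<in>A. (?K x * ?N (\<lambda>x. ennreal ((cmod (u x))\<^sup>2)) x) \<partial>M) \<le> (\<integral>\<^sup>+x\<in>A. ennreal B \<partial>M)" .
  qed simp_all
  then show thesis by (rule that)
qed

end

section \<open>Reduction of T to normal form and the pointwise comparison\<close>

theorem theorem2p8:
  fixes M F :: "'a measure" and u w :: "'a \<Rightarrow> complex"
  assumes "complete_measure M"
    and "sigma_finite_measure M"
    and "sigma_finite_subalgebra M F"
    and "u \<in> DE M F" and "w \<in> DE M F"
    and "\<forall>f\<in>L2 M. (\<lambda>x. u x * f x) \<in> DE M F"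
    and "bounded_op M (wcte M F w u)"
  shows "((AE x in M. (cmod (cE M F (\<lambda>y. u y * w y) x))^2 \<ge>
              real_cond_exp M F (\<lambda>y. (cmod (u y))^2) x *
              real_cond_exp M F (\<lambda>y. (cmod (w y))^2) x)
            \<longrightarrow> quasi_star_A M (wcte M F w u))
       \<and> (quasi_star_A M (wcte M F w u) \<longrightarrow>
           (AE x in M. (cmod (cE M F (\<lambda>y. u y * w y) x))^3 *
                 (real_cond_exp M F (\<lambda>y. (cmod (w y))^2) x) powr (1/2) \<ge>
              (real_cond_exp M F (\<lambda>y. (cmod (u y))^2) x) powr (3/2) *
                 (real_cond_exp M F (\<lambda>y. (cmod (w y))^2) x)^2))"
proof -
  interpret sigma_finite_subalgebra M F by (rule assms(3))
  have u [measurable]: "u \<in> borel_measurable M" and w [measurable]: "w \<in> borel_measurable M"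
    using assms(4,5) by (auto simp: DE_def)
  note T = assms(7)
  define nJ where "nJ = nn_cond_exp M F (\<lambda>x. ennreal ((cmod (u x))\<^sup>2))"
  define nK where "nK = nn_cond_exp M F (\<lambda>x. ennreal ((cmod (w x))\<^sup>2))"
  define e where "e = cE M F (\<lambda>y. u y * w y)"
  have nJ [measurable]: "nJ \<in> borel_measurable F" and nK [measurable]: "nK \<in> borel_measurable F"
    unfolding nJ_def nK_def by measurable
  note [measurable] = F_meas_imp_M_meas[OF nJ] F_meas_imp_M_meas[OF nK]
  obtain B :: real where B: "AE x in M. nK x * nJ x \<le> ennreal B"
    unfolding nK_def nJ_def by (rule wcte_bound[OF u w T])
  \<comment> \<open>Putting the almost everywhere bound into S makes k bounded at every
    point.\<close>
  define S where "S = {x\<in>space F. 0 < nJ x \<and> nJ x < \<infinity> \<and> 0 < nK x \<and> nK x < \<infinity> \<and> nK x * nJ x \<le> ennreal B}"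
  have SF [measurable]: "S \<in> sets F" unfolding S_def by measurable
  note SM [measurable] = sets_F[OF SF]
  define J where "J x = enn2real (nJ x)" for x
  define K where "K x = enn2real (nK x)" for x
  have [measurable]: "J \<in> borel_measurable F" "K \<in> borel_measurable F" unfolding J_def K_def by measurable
  note [measurable] = this[THEN F_meas_imp_M_meas]
  have JK0: "0 \<le> J x" "0 \<le> K x" for x by (simp_all add: J_def K_def)
  have JK_pos: "0 < J x" "0 < K x" "nJ x = ennreal (J x)" "nK x = ennreal (K x)" "J x * K x \<le> max B 0" if "x \<in> S" for x
  proof -
    show J: "nJ x = ennreal (J x)" and K: "nK x = ennreal (K x)" "0 < J x" "0 < K x"
      using that by (auto simp: S_def J_def K_def enn2real_positive_iff)
    have "ennreal (K x * J x) \<le> ennreal (max B 0)"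
      using that J K(1) JK0 by (auto simp: S_def ennreal_mult intro: order_trans ennreal_leI)
    then have "K x * J x \<le> max B 0" by (subst (asm) ennreal_le_iff) simp_all
    then show "J x * K x \<le> max B 0" by (simp only: mult.commute)
  qed
  \<comment> \<open>If both expectations were nonzero and one infinite, their product would be
    infinite, contrary to the bound B.\<close>
  have off_S: "AE x in M. x \<notin> S \<longrightarrow> nJ x = 0 \<or> nK x = 0"
    using B AE_space
  proof eventually_elim
    case (elim x)
    show ?case
    proof (intro impI, rule ccontr)
      assume x: "x \<notin> S" "\<not> (nJ x = 0 \<or> nK x = 0)"
      then have "nJ x \<noteq> \<infinity>" "nK x \<noteq> \<infinity>"
        using elim(1) by (auto simp: ennreal_top_mult ennreal_mult_top top_unique)
      then show False using x elim by (auto simp: S_def space_F less_top zero_less_iff_neq_zero)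
    qed
  qed
  define \<alpha> where "\<alpha> x = indicator S x / sqrt (J x)" for x
  define \<beta> where "\<beta> x = indicator S x / sqrt (K x)" for x
  have [measurable]: "\<alpha> \<in> borel_measurable F" "\<beta> \<in> borel_measurable F" unfolding \<alpha>_def \<beta>_def by measurable
  note [measurable] = this[THEN F_meas_imp_M_meas]
  define a where "a x = cnj (u x) * of_real (\<alpha> x)" for x
  define b where "b x = w x * of_real (\<beta> x)" for x
  define k where "k x = indicator S x * sqrt (J x * K x)" for x
  have a [measurable]: "a \<in> borel_measurable M" and b [measurable]: "b \<in> borel_measurable M"
    unfolding a_def b_def by measurable
  \<comment> \<open>The factor 1_S / G is F-measurable and leaves the conditional expectation, where
    it meets G. The statement serves both cnj u with J and w with K.\<close>
  have normalize: "AE x in M. nn_cond_exp M F (\<lambda>x. ennreal ((cmod (g x * of_real (indicator S x / sqrt (G x))))\<^sup>2)) x = indicator S x"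
    if [measurable]: "g \<in> borel_measurable M" "G \<in> borel_measurable F"
      and G: "\<And>x. x \<in> S \<Longrightarrow> 0 < G x \<and> nn_cond_exp M F (\<lambda>x. ennreal ((cmod (g x))\<^sup>2)) x = ennreal (G x)"
    for g :: "'a \<Rightarrow> complex" and G :: "'a \<Rightarrow> real"
  proof -
    have eq: "(\<lambda>x. ennreal ((cmod (g x * of_real (indicator S x / sqrt (G x))))\<^sup>2))
        = (\<lambda>x. ennreal (indicator S x / G x) * ennreal ((cmod (g x))\<^sup>2))"
    proof
      fix x
      show "ennreal ((cmod (g x * of_real (indicator S x / sqrt (G x))))\<^sup>2)
          = ennreal (indicator S x / G x) * ennreal ((cmod (g x))\<^sup>2)"
        using G[of x] by (cases "x \<in> S")
          (simp_all add: norm_mult norm_divide power_mult_distrib power_divide mult.commute flip: ennreal_mult)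
    qed
    have "AE x in M. ennreal (indicator S x / G x) * nn_cond_exp M F (\<lambda>x. ennreal ((cmod (g x))\<^sup>2)) x
        = nn_cond_exp M F (\<lambda>x. ennreal (indicator S x / G x) * ennreal ((cmod (g x))\<^sup>2)) x"
      by (rule nn_cond_exp_prod) measurable
    then show ?thesis unfolding eq
    proof eventually_elim
      case (elim x)
      show ?case unfolding elim[symmetric]
        using G[of x] by (cases "x \<in> S") (simp_all flip: ennreal_mult)
    qed
  qed
  have Sa: "AE x in M. nn_cond_exp M F (\<lambda>x. ennreal ((cmod (a x))\<^sup>2)) x = indicator S x"
    using normalize[of "\<lambda>x. cnj (u x)" J] JK_pos by (simp add: a_def \<alpha>_def nJ_def)
  have Sb: "AE x in M. nn_cond_exp M F (\<lambda>x. ennreal ((cmod (b x))\<^sup>2)) x = indicator S x"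
    using normalize[of w K] JK_pos by (simp add: b_def \<beta>_def nK_def)
  have k0: "0 \<le> k x" for x by (simp add: k_def JK0)
  have km: "bounded_multiplier (\<lambda>x. complex_of_real (k x))"
  proof -
    have "cmod (complex_of_real (k x)) \<le> sqrt (max B 0)" for x
      using JK_pos(5)[of x] JK0 by (cases "x \<in> S") (auto simp: k_def)
    then show ?thesis unfolding bounded_multiplier_def k_def by (intro conjI exI AE_I2) measurable
  qed
  have TW: "op_eq M (wcte M F w u) (weighted_cond_op (\<lambda>x. of_real (k x)) a b)"
  proof (rule op_eqI)
    fix f assume "f \<in> L2 M"
    then have [measurable]: "f \<in> borel_measurable M" by (rule L2_D)
    let ?E = "cE M F (\<lambda>y. u y * f y)"
    have "(\<lambda>y. cnj (a y) * f y) = (\<lambda>y. of_real (\<alpha> y) * (u y * f y))" by (simp add: a_def mult_ac)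
    then have "AE x in M. cE M F (\<lambda>y. cnj (a y) * f y) x = of_real (\<alpha> x) * ?E x"
      using cE_mult_real[of \<alpha> "\<lambda>y. u y * f y"] by simp
    \<comment> \<open>Where E(|u|^2) vanishes, u vanishes too. Since that set is in F, its indicator
      passes through E and shows that E(u f) is 0 there; together with the same fact for w, T f is 0
      off S.\<close>
    moreover have "AE x in M. nJ x = 0 \<longrightarrow> ?E x = 0"
    proof -
      define z :: "'a \<Rightarrow> real" where "z x = indicator {x\<in>space F. nJ x = 0} x" for x
      have z [measurable]: "z \<in> borel_measurable F" unfolding z_def by measurable
      note [measurable] = F_meas_imp_M_meas[OF z]
      have "AE x in M. nJ x = 0 \<longrightarrow> ennreal ((cmod (u x))\<^sup>2) = 0"
        unfolding nJ_def by (rule nn_cond_exp_eq_0) measurable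
      then have "AE x in M. of_real (z x) * (u x * f x) = of_real 0 * (u x * f x)"
        by eventually_elim (auto simp: z_def indicator_def)
      then have "AE x in M. cE M F (\<lambda>x. of_real (z x) * (u x * f x)) x = cE M F (\<lambda>x. of_real 0 * (u x * f x)) x"
        by (rule cE_cong) measurable
      moreover have "AE x in M. cE M F (\<lambda>x. of_real (z x) * (u x * f x)) x = of_real (z x) * ?E x"
        by (rule cE_mult_real) measurable
      moreover have "AE x in M. cE M F (\<lambda>x. of_real 0 * (u x * f x)) x = of_real 0 * ?E x"
        by (rule cE_mult_real) measurable
      ultimately show ?thesis using AE_space
        by eventually_elim (auto simp: z_def space_F)
    qed
    moreover have "AE x in M. nK x = 0 \<longrightarrow> ennreal ((cmod (w x))\<^sup>2) = 0"
      unfolding nK_def by (rule nn_cond_exp_eq_0) measurable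
    ultimately show "AE x in M. wcte M F w u f x = weighted_cond_op (\<lambda>x. of_real (k x)) a b f x"
      using off_S
    proof eventually_elim
      case (elim x)
      show ?case
      proof (cases "x \<in> S")
        case True
        have "\<beta> x * k x * \<alpha> x = 1"
          using JK_pos(1,2)[OF True] True by (simp add: \<beta>_def \<alpha>_def k_def real_sqrt_mult)
        then have "complex_of_real (\<beta> x) * of_real (k x) * of_real (\<alpha> x) = 1"
          by (simp flip: of_real_mult)
        then have "wcte M F w u f x = (complex_of_real (\<beta> x) * of_real (k x) * of_real (\<alpha> x)) * (w x * ?E x)"
          by (simp add: wcte_def)
        also have "\<dots> = weighted_cond_op (\<lambda>x. of_real (k x)) a b f x"
          unfolding weighted_cond_op_def elim(1) by (simp add: b_def mult_ac)
        finally show ?thesis .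
      next
        case False
        then have "?E x = 0 \<or> w x = 0" using elim by auto
        then show ?thesis using False by (auto simp: wcte_def weighted_cond_op_def b_def \<beta>_def)
      qed
    qed
  qed
  define c where "c = cE M F (\<lambda>y. cnj (a y) * b y)"
  have iff: "quasi_star_A M (wcte M F w u) \<longleftrightarrow> (AE x in M. (k x)^4 \<le> (k x)^4 * (cmod (c x))^3)"
    unfolding c_def
    by (rule quasi_star_A_weighted_cond_op_iff[OF a b Sa Sb SF _ km k0 T TW]) (simp add: k_def)
  have c: "AE x in M. c x = of_real (\<alpha> x * \<beta> x) * e x"
  proof -
    have "(\<lambda>y. cnj (a y) * b y) = (\<lambda>y. of_real (\<alpha> y * \<beta> y) * (u y * w y))"
      by (simp add: a_def b_def mult_ac)
    then show ?thesis using cE_mult_real[of "\<lambda>x. \<alpha> x * \<beta> x" "\<lambda>y. u y * w y"]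
      unfolding c_def e_def by simp
  qed
  \<comment> \<open>On S the factor k^4 is positive and cancels, leaving |c| \<ge> 1, where |c| =
    |E(uw)| / sqrt(J K).\<close>
  have ptw: "((k x)^4 \<le> (k x)^4 * (cmod (c x))^3) \<longleftrightarrow> J x * K x \<le> (cmod (e x))\<^sup>2"
    if x: "x \<in> S" and c: "c x = of_real (\<alpha> x * \<beta> x) * e x" for x
  proof -
    have "0 < k x" using JK_pos(1,2)[OF x] x by (simp add: k_def)
    have "cmod (c x) = cmod (e x) / sqrt (J x * K x)"
      using x JK0 by (simp add: c norm_mult norm_divide \<alpha>_def \<beta>_def real_sqrt_mult)
    then have "1 \<le> cmod (c x) \<longleftrightarrow> sqrt (J x * K x) \<le> cmod (e x)"
      using JK_pos(1,2)[OF x] by (simp add: le_divide_eq)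
    also have "\<dots> \<longleftrightarrow> J x * K x \<le> (cmod (e x))\<^sup>2"
      using power_mono_iff[of "sqrt (J x * K x)" "cmod (e x)" 2] JK0 by simp
    finally show ?thesis
      using \<open>0 < k x\<close> power_mono_iff[of 1 "cmod (c x)" 3] by simp
  qed
  have Jeq: "AE x in M. real_cond_exp M F (\<lambda>y. (cmod (u y))\<^sup>2) x = J x"
    unfolding J_def nJ_def by (rule real_cond_exp_nonneg) auto
  have Keq: "AE x in M. real_cond_exp M F (\<lambda>y. (cmod (w y))\<^sup>2) x = K x"
    unfolding K_def nK_def by (rule real_cond_exp_nonneg) auto
  show ?thesis
    unfolding iff e_def[symmetric]
  proof (intro conjI impI)
    assume "AE x in M. (cmod (e x))\<^sup>2 \<ge> real_cond_exp M F (\<lambda>y. (cmod (u y))\<^sup>2) x * real_cond_exp M F (\<lambda>y. (cmod (w y))\<^sup>2) x"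
    then show "AE x in M. (k x)^4 \<le> (k x)^4 * (cmod (c x))^3"
      using c Jeq Keq
    proof eventually_elim
      case (elim x)
      \<comment> \<open>Off S both sides are 0 because k is.\<close>
      then show ?case using ptw[of x] by (cases "x \<in> S") (auto simp: k_def)
    qed
  next
    assume "AE x in M. (k x)^4 \<le> (k x)^4 * (cmod (c x))^3"
    then show "AE x in M. (cmod (e x))^3 * (real_cond_exp M F (\<lambda>y. (cmod (w y))\<^sup>2) x) powr (1/2)
        \<ge> (real_cond_exp M F (\<lambda>y. (cmod (u y))\<^sup>2) x) powr (3/2) * (real_cond_exp M F (\<lambda>y. (cmod (w y))\<^sup>2) x)\<^sup>2"
      using c Jeq Keq off_S
    proof eventually_elim
      case (elim x)
      show ?case
      proof (cases "x \<in> S")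
        case True
        \<comment> \<open>Square roots remove the fractional exponents: the claim becomes p^3 q^4
          \<le> |E(uw)|^3 q, the cube of p q \<le> |E(uw)| multiplied by q.\<close>
        define p q where "p = sqrt (J x)" and "q = sqrt (K x)"
        have pq: "0 < p" "0 < q" "J x = p\<^sup>2" "K x = q\<^sup>2"
          using JK_pos(1,2)[OF True] by (simp_all add: p_def q_def)
        have "(p * q)\<^sup>2 \<le> (cmod (e x))\<^sup>2"
          using ptw[OF True elim(2)] elim(1) pq(3,4) by (simp add: power_mult_distrib)
        then have "p * q \<le> cmod (e x)" by (rule power2_le_imp_le) simp
        then have "(p * q)^3 * q \<le> (cmod (e x))^3 * q"
          using pq by (intro mult_right_mono power_mono) auto
        moreover have "(p\<^sup>2) powr (3/2) = p^3" "(q\<^sup>2) powr (1/2) = q"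
          using pq(1,2) by (simp_all add: powr_powr flip: powr_numeral)
        ultimately show ?thesis
          unfolding elim(3,4) pq(3,4) by (simp add: power_mult_distrib power2_eq_square power3_eq_cube mult_ac)
      next
        case False
        \<comment> \<open>The right side of the claim is then 0, since \<open>0 powr (3/2)\<close>
          is 0; an infinite expectation also enters as 0 through \<open>enn2real\<close>.\<close>
        then have "J x = 0 \<or> K x = 0" using elim(5) by (auto simp: J_def K_def)
        then show ?thesis unfolding elim(3,4) by auto
      qed
    qed
  qed
qed

end
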